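(* Let $r$ and $d$ be integers with $4 \leq r \leq d$. Then there exists a connected finite simple graph $G = G_{r,d}$, with edge set $E$, such that its toric ideal $I_G$ satisfies $\operatorname{reg}(\mathbb{K}[E]/I_G) = r$ and $\deg h_{\mathbb{K}[E]/I_G}(x) = d$.
   Context: $\mathbb{K}$ is an algebraically closed field of characteristic zero. For a finite simple graph $G$ with vertex set $V=\{v_1,\dots,v_n\}$ and edge set $E=\{e_1,\dots,e_q\}$, the toric ideal $I_G$ is the kernel of the $\mathbb{K}$-algebra map $\varphi:\mathbb{K}[E]=\mathbb{K}[e_1,\dots,e_q]\to \mathbb{K}[v_1,\dots,v_n]$, $\varphi(e_i)=v_{i_1}v_{i_2}$ where $e_i=\{v_{i_1},v_{i_2}\}$; $\mathbb{K}[E]$ is standard graded. For a homogeneous ideal $I$ of a standard graded polynomial ring $R$, $\operatorname{reg}(R/I)=\max\{j-i : \beta_{i,j}(R/I)\neq 0\}$ is the Castelnuovo–Mumford regularity, and the $h$-polynomial $h_{R/I}(x)\in\mathbb{Z}[x]$ is the polynomial with $HS_{R/I}(x)=\sum_{i\ge 0}\dim_{\mathbb{K}}(R/I)_i x^i = h_{R/I}(x)/(1-x)^{\dim(R/I)}$ and $h_{R/I}(1)\neq 0$, where $\dim$ is Krull dimension. *)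

theory Defs
  imports "HOL-Computational_Algebra.Polynomial_FPS"
begin

(* A finite simple graph on vertex set {..<n} with q edges e_0,...,e_{q-1};
   ed i is the (2-element) vertex set of edge e_i; distinct indices give distinct edges. *)
definition simple_graph :: "nat \<Rightarrow> nat \<Rightarrow> (nat \<Rightarrow> nat set) \<Rightarrow> bool" where
  "simple_graph n q ed \<longleftrightarrow>
     (\<forall>i<q. ed i \<subseteq> {..<n} \<and> card (ed i) = 2) \<and> inj_on ed {..<q}"

definition connected_graph :: "nat \<Rightarrow> nat \<Rightarrow> (nat \<Rightarrow> nat set) \<Rightarrow> bool" where
  "connected_graph n q ed \<longleftrightarrow> 1 \<le> n \<and>
     (\<forall>u<n. \<forall>v<n. (u, v) \<in> {(x, y). \<exists>i<q. ed i = {x, y}}\<^sup>*)"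

(* exponent vector (over the vertices) of phi(e_i) = v_a v_b *)
definition edge_vec :: "(nat \<Rightarrow> nat set) \<Rightarrow> nat \<Rightarrow> nat \<Rightarrow> nat" where
  "edge_vec ed i = (\<lambda>v. if v \<in> ed i then 1 else 0)"

(* exponent vectors of the monomials of degree k in the edge ring K[E]/I_G = K[phi(E)]:
   images under phi of the degree-k monomials of K[E] *)
definition edge_monos :: "nat \<Rightarrow> (nat \<Rightarrow> nat set) \<Rightarrow> nat \<Rightarrow> (nat \<Rightarrow> nat) set" where
  "edge_monos q ed k =
     {(\<lambda>v. \<Sum>i<q. c i * edge_vec ed i v) | c :: nat \<Rightarrow> nat. (\<Sum>i<q. c i) = k}"

(* Hilbert function: dim_K (K[E]/I_G)_k *)
definition hilbert_fun :: "nat \<Rightarrow> (nat \<Rightarrow> nat set) \<Rightarrow> nat \<Rightarrow> nat" where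
  "hilbert_fun q ed k = card (edge_monos q ed k)"

definition hilbert_series :: "nat \<Rightarrow> (nat \<Rightarrow> nat set) \<Rightarrow> int fps" where
  "hilbert_series q ed = Abs_fps (\<lambda>k. int (hilbert_fun q ed k))"

(* h is the h-polynomial: HS(x) = h(x)/(1-x)^D with h(1) \<noteq> 0 *)
definition is_h_polynomial :: "nat \<Rightarrow> (nat \<Rightarrow> nat set) \<Rightarrow> int poly \<Rightarrow> bool" where
  "is_h_polynomial q ed h \<longleftrightarrow>
     (\<exists>D::nat. fps_of_poly h = hilbert_series q ed * (1 - fps_X) ^ D \<and> poly h 1 \<noteq> 0)"

(* Linear algebra: rank of the matrix (M b a)_{b\<in>B, a\<in>A} over the field 'k *)
definition cols_indep :: "'b set \<Rightarrow> ('b \<Rightarrow> 'a \<Rightarrow> 'k::field) \<Rightarrow> 'a set \<Rightarrow> bool" where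
  "cols_indep B M S \<longleftrightarrow>
     (\<forall>w. (\<forall>b\<in>B. (\<Sum>a\<in>S. w a * M b a) = 0) \<longrightarrow> (\<forall>a\<in>S. w a = 0))"

definition mat_rank :: "'b set \<Rightarrow> 'a set \<Rightarrow> ('b \<Rightarrow> 'a \<Rightarrow> 'k::field) \<Rightarrow> nat" where
  "mat_rank B A M = Max (card ` {S. S \<subseteq> A \<and> cols_indep B M S})"

(* Koszul complex K(e_0,...,e_{q-1}; K[E]/I_G) computing Tor^{K[E]}_i(K[E]/I_G, K)_j.
   Basis of homological degree i, internal degree j: e_F \<otimes> m, |F| = i, m a monomial of
   degree j - i of K[E]/I_G. *)
definition koszul_basis :: "nat \<Rightarrow> (nat \<Rightarrow> nat set) \<Rightarrow> nat \<Rightarrow> nat \<Rightarrow> (nat set \<times> (nat \<Rightarrow> nat)) set" where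
  "koszul_basis q ed i j =
     {(F, m). F \<subseteq> {..<q} \<and> card F = i \<and> i \<le> j \<and> m \<in> edge_monos q ed (j - i)}"

(* coefficient of e_F' \<otimes> m' in d(e_F \<otimes> m) = \<Sum>_{f\<in>F} (-1)^{#{g\<in>F. g<f}} e_{F-{f}} \<otimes> phi(e_f) m *)
definition koszul_coef :: "(nat \<Rightarrow> nat set) \<Rightarrow> (nat set \<times> (nat \<Rightarrow> nat)) \<Rightarrow> (nat set \<times> (nat \<Rightarrow> nat)) \<Rightarrow> 'k::field" where
  "koszul_coef ed tgt src =
     (let F' = fst tgt; m' = snd tgt; F = fst src; m = snd src in
      if F' \<subseteq> F \<and> card (F - F') = 1 \<and>
         m' = (\<lambda>v. m v + edge_vec ed (the_elem (F - F')) v)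
      then (- 1) ^ card {g \<in> F. g < the_elem (F - F')} else 0)"

(* graded Betti number beta_{i,j}(K[E]/I_G) over the field 'k:
   dim ker d_i - rank d_{i+1} in internal degree j *)
definition betti :: "'k::field itself \<Rightarrow> nat \<Rightarrow> (nat \<Rightarrow> nat set) \<Rightarrow> nat \<Rightarrow> nat \<Rightarrow> nat" where
  "betti K q ed i j =
     card (koszul_basis q ed i j)
     - mat_rank (koszul_basis q ed (i - 1) j) (koszul_basis q ed i j)
         (koszul_coef ed :: _ \<Rightarrow> _ \<Rightarrow> 'k)
     - mat_rank (koszul_basis q ed i j) (koszul_basis q ed (i + 1) j)
         (koszul_coef ed :: _ \<Rightarrow> _ \<Rightarrow> 'k)"

(* reg(K[E]/I_G) = r *)
definition regularity_is :: "'k::field itself \<Rightarrow> nat \<Rightarrow> (nat \<Rightarrow> nat set) \<Rightarrow> int \<Rightarrow> bool" where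
  "regularity_is K q ed r \<longleftrightarrow>
     (\<exists>i j. betti K q ed i j \<noteq> 0 \<and> int j - int i = r) \<and>
     (\<forall>i j. betti K q ed i j \<noteq> 0 \<longrightarrow> int j - int i \<le> r)"

end

theory Submission
  imports Defs "HOL-Library.Function_Algebras"
begin

text \<open>
  Take an odd cycle of length \<open>2a + 1\<close> through \<open>x\<close> and a triangle through \<open>y\<close>, and join \<open>x\<close> and \<open>y\<close> by
  \<open>k\<close> paths \<open>x, z_j, y\<close> with edges \<open>p_j = x z_j\<close>, \<open>s_j = y z_j\<close>. The toric ideal is generated by
  \<open>p_i s_j - p_j s_i\<close> and \<open>p_i p_j A - s_i s_j B\<close>, where \<open>A\<close> and \<open>B\<close> are the products of the odd and of the
  even cycle edges, each of degree \<open>N = a + 2\<close>. Hence there is a minimal generator of degree \<open>N + 2\<close>.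

  Modulo \<open>p_j\<close>, and once \<open>z_0, ..., z_(j-1)\<close> are no longer used, the multiples of \<open>z_j\<close> form a cyclic
  module with monomial relations, generated by \<open>s_j\<close>; the remaining monomials avoid \<open>z_j\<close>. This
  splitting yields the Hilbert series with numerator of degree \<open>N + k\<close>. It also yields an acyclic
  matching of the Koszul cells in which every cell with monomial part of degree at least \<open>N + 2\<close> is
  matched, so that the regularity is \<open>N + 1\<close>. Choose \<open>N = r - 1\<close> and \<open>k = d - r + 1\<close>.
\<close>

section \<open>Koszul homology and matchings\<close>

text \<open>The degree of the \<open>h\<close>-polynomial can exceed the regularity because of a
  summand of small dimension. Modulo \<open>p_j\<close>, the element \<open>s_j\<close> is killed by
  every \<open>p_i\<close> and by every \<open>B s_i\<close>. Hence the multiples of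
  \<open>B s_j\<close> form a copy of the polynomial ring in the \<open>2 * N\<close> cycle edges
  alone, shifted by \<open>N + 1\<close>. With \<open>l\<close> later path vertices, this piece adds
  \<open>x^(N+1) (1 - x)^l\<close> to the numerator over the common denominator. Its degree grows
  with the number of paths, while the degree \<open>N + 1\<close> of its generator, which bounds the
  monomial part of every unmatched cell, does not.

  Betti numbers are given as a cell count minus two ranks of explicit matrices. Vanishing therefore
  needs only lower bounds for the ranks, that is, independent columns. Nonvanishing needs an upper
  bound for their sum, which comes from one cycle and one functional that kills all
  boundaries.\<close>

lemma mat_rank_ge:
  assumes "finite A" "S \<subseteq> A" "cols_indep B M S"
  shows "card S \<le> mat_rank B A M"
proof -
  have "finite {S. S \<subseteq> A \<and> cols_indep B M S}"
    using assms(1) by (auto intro: finite_subset[of _ "Pow A"])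
  then show ?thesis
    unfolding mat_rank_def using assms by (intro Max_ge) auto
qed

lemma mat_rank_attained:
  assumes "finite A"
  obtains S where "S \<subseteq> A" "cols_indep B M S" "card S = mat_rank B A M"
proof -
  let ?I = "{S. S \<subseteq> A \<and> cols_indep B M S}"
  have "finite ?I"
    using assms by (auto intro: finite_subset[of _ "Pow A"])
  moreover have "{} \<in> ?I"
    by (simp add: cols_indep_def)
  ultimately have "Max (card ` ?I) \<in> card ` ?I"
    by (intro Max_in) auto
  then show ?thesis
    using that unfolding mat_rank_def by auto
qed

text \<open>Vanishing outside \<open>R\<close> makes the exponent function of a monomial unique and
  the set finite; in \<open>edge_monos\<close> the values of \<open>c\<close> from \<open>q\<close>
  on are arbitrary.\<close>

definition monos_on :: "nat set \<Rightarrow> nat \<Rightarrow> (nat \<Rightarrow> nat) set" where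
  "monos_on R d = {u. (\<forall>x. x \<notin> R \<longrightarrow> u x = 0) \<and> sum u R = d}"

lemma finite_monos_on:
  assumes "finite R"
  shows "finite (monos_on R d)"
proof -
  have "monos_on R d \<subseteq> {f. \<forall>x. (x \<in> R \<longrightarrow> f x \<in> {..d}) \<and> (x \<notin> R \<longrightarrow> f x = 0)}"
    using member_le_sum[OF _ _ assms] by (fastforce simp: monos_on_def)
  then show ?thesis
    by (rule finite_subset) (intro finite_set_of_finite_funs assms finite_atMost)
qed

definition edge_val :: "nat \<Rightarrow> (nat \<Rightarrow> nat set) \<Rightarrow> (nat \<Rightarrow> nat) \<Rightarrow> nat \<Rightarrow> nat" where
  "edge_val q ed c = (\<lambda>v. \<Sum>i<q. c i * edge_vec ed i v)"

definition unit_exp :: "nat \<Rightarrow> nat \<Rightarrow> nat" where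
  "unit_exp i = (\<lambda>x. if x = i then 1 else 0)"

definition set_exp :: "nat set \<Rightarrow> nat \<Rightarrow> nat" where
  "set_exp F = (\<lambda>x. if x \<in> F then 1 else 0)"

lemma edge_val_add: "edge_val q ed (c + c') = edge_val q ed c + edge_val q ed c'"
  by (auto simp: edge_val_def fun_eq_iff sum.distrib algebra_simps)

lemma edge_val_unit: "i < q \<Longrightarrow> edge_val q ed (unit_exp i) = edge_vec ed i"
  by (auto simp: edge_val_def unit_exp_def fun_eq_iff if_distrib[of "\<lambda>x. x * _"] cong: if_cong)

lemma edge_val_cong: "(\<And>i. i < q \<Longrightarrow> c i = c' i) \<Longrightarrow> edge_val q ed c = edge_val q ed c'"
  by (auto simp: edge_val_def fun_eq_iff)

lemma edge_monos_eq: "edge_monos q ed d = edge_val q ed ` monos_on {..<q} d"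
proof (intro equalityI subsetI)
  fix m assume "m \<in> edge_monos q ed d"
  then obtain c where c: "m = edge_val q ed c" "sum c {..<q} = d"
    by (auto simp: edge_monos_def edge_val_def)
  let ?c = "\<lambda>i. if i < q then c i else 0"
  have "m = edge_val q ed ?c"
    unfolding c by (rule edge_val_cong) auto
  moreover have "?c \<in> monos_on {..<q} d"
    using c by (auto simp: monos_on_def)
  ultimately show "m \<in> edge_val q ed ` monos_on {..<q} d"
    by blast
qed (auto simp: edge_monos_def edge_val_def monos_on_def)

lemma finite_edge_monos: "finite (edge_monos q ed d)"
  by (simp add: edge_monos_eq finite_monos_on)

lemma edge_monos_add_edge:
  assumes "m \<in> edge_monos q ed d" "f < q"
  shows "m + edge_vec ed f \<in> edge_monos q ed (Suc d)"
proof -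
  obtain c where c: "m = edge_val q ed c" "c \<in> monos_on {..<q} d"
    using assms by (auto simp: edge_monos_eq)
  have "m + edge_vec ed f = edge_val q ed (c + unit_exp f)"
    using assms c by (simp add: edge_val_add edge_val_unit)
  moreover have "c + unit_exp f \<in> monos_on {..<q} (Suc d)"
    using c assms by (auto simp: monos_on_def unit_exp_def sum.distrib)
  ultimately show ?thesis
    by (auto simp: edge_monos_eq)
qed

lemma finite_koszul_basis: "finite (koszul_basis q ed i j)"
proof -
  have "koszul_basis q ed i j \<subseteq> Pow {..<q} \<times> edge_monos q ed (j - i)"
    by (auto simp: koszul_basis_def)
  then show ?thesis
    by (rule finite_subset) (auto simp: finite_edge_monos)
qed

lemma koszul_coef_nonzero:
  assumes "koszul_coef ed (G, l) (F, m) \<noteq> (0 :: 'k :: field)" 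
  obtains g where "g \<in> F" "G = F - {g}" "l = m + edge_vec ed g"
proof -
  have "G \<subseteq> F" "card (F - G) = 1" "l = (\<lambda>v. m v + edge_vec ed (the_elem (F - G)) v)"
    using assms by (auto simp: koszul_coef_def Let_def split: if_splits)
  moreover from this obtain g where "F - G = {g}"
    by (auto simp: card_1_singleton_iff)
  ultimately show ?thesis
    by (intro that[of g]) (auto simp: fun_eq_iff)
qed

lemma koszul_coef_face:
  assumes "g \<in> F"
  shows "koszul_coef ed (F - {g}, m + edge_vec ed g) (F, m) = ((- 1) ^ card {x \<in> F. x < g} :: 'k :: field)"
proof -
  have *: "F - (F - {g}) = {g}"
    using assms by auto
  show ?thesis
    by (auto simp: koszul_coef_def Let_def * fun_eq_iff)
qed

lemma koszul_basis_face:
  assumes "(F, m) \<in> koszul_basis q ed i j" "g \<in> F"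
  shows "(F - {g}, m + edge_vec ed g) \<in> koszul_basis q ed (i - 1) j"
proof -
  have F: "F \<subseteq> {..<q}" "card F = i" "i \<le> j" "m \<in> edge_monos q ed (j - i)"
    using assms by (auto simp: koszul_basis_def)
  have "finite F"
    using F(1) by (rule finite_subset) simp
  then have "i > 0"
    using F(2) assms(2) by (auto simp: card_gt_0_iff)
  then have "Suc (j - i) = j - (i - 1)"
    using F(3) by auto
  then show ?thesis
    using edge_monos_add_edge[OF F(4), of g] F assms(2) \<open>finite F\<close>
    by (auto simp: koszul_basis_def)
qed

text \<open>
  Acyclic matching: cells with the same class are paired by toggling one index that depends on the
  class only. In the faces of cells of the same class the pairing is visible as a diagonal, and all other
  faces have smaller rank, so the upper cells of the pairs are independent columns.
\<close>

lemma betti_eq_0_if_matching: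
  fixes \<kappa> :: "nat set \<times> (nat \<Rightarrow> nat) \<Rightarrow> 'c" and \<rho> :: "'c \<Rightarrow> nat" and \<phi> :: "'c \<Rightarrow> nat option"
  assumes face: "\<And>i F m g. (F, m) \<in> koszul_basis q ed i j \<Longrightarrow> g \<in> F \<Longrightarrow>
      \<kappa> (F - {g}, m + edge_vec ed g) = \<kappa> (F, m) \<or> \<rho> (\<kappa> (F - {g}, m + edge_vec ed g)) < \<rho> (\<kappa> (F, m))"
    and up: "\<And>i F m f. (F, m) \<in> koszul_basis q ed i j \<Longrightarrow> \<phi> (\<kappa> (F, m)) = Some f \<Longrightarrow> f \<notin> F \<Longrightarrow>
      \<exists>m'. (insert f F, m') \<in> koszul_basis q ed (i + 1) j \<and> m = m' + edge_vec ed f \<and> \<kappa> (insert f F, m') = \<kappa> (F, m)"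
    and down: "\<And>i F m f. (F, m) \<in> koszul_basis q ed i j \<Longrightarrow> \<phi> (\<kappa> (F, m)) = Some f \<Longrightarrow> f \<in> F \<Longrightarrow>
      \<kappa> (F - {f}, m + edge_vec ed f) = \<kappa> (F, m)"
    and matched: "\<And>F m. (F, m) \<in> koszul_basis q ed i0 j \<Longrightarrow> \<phi> (\<kappa> (F, m)) \<noteq> None"
  shows "betti TYPE('k :: field) q ed i0 j = 0"
proof -
  define U where "U i = {a \<in> koszul_basis q ed i j. \<exists>f\<in>fst a. \<phi> (\<kappa> a) = Some f}" for i
  have U_sub: "U i \<subseteq> koszul_basis q ed i j" for i
    by (auto simp: U_def)
  have fin_U: "finite (U i)" for i
    using U_sub finite_koszul_basis by (rule finite_subset)
  have indep: "cols_indep (koszul_basis q ed (i - 1) j) (koszul_coef ed :: _ \<Rightarrow> _ \<Rightarrow> 'k) (U i)" for i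
    unfolding cols_indep_def
  proof (intro allI impI)
    fix w :: "_ \<Rightarrow> 'k"
    assume rel: "\<forall>b\<in>koszul_basis q ed (i - 1) j. (\<Sum>a\<in>U i. w a * koszul_coef ed b a) = 0"
    show "\<forall>a\<in>U i. w a = 0"
    proof (rule ccontr)
      assume "\<not> ?thesis"
      then have ne: "{a \<in> U i. w a \<noteq> 0} \<noteq> {}"
        by blast
      let ?R = "(\<rho> \<circ> \<kappa>) ` {a \<in> U i. w a \<noteq> 0}"
      have fin: "finite ?R"
        using fin_U by simp
      have "Max ?R \<in> ?R"
        using fin ne by (intro Max_in) auto
      then obtain a where a: "a \<in> U i" "w a \<noteq> 0" and Max: "Max ?R = \<rho> (\<kappa> a)"
        by auto
      have max: "\<rho> (\<kappa> b) \<le> \<rho> (\<kappa> a)" if "b \<in> U i" "w b \<noteq> 0" for b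
        using Max_ge[OF fin, of "\<rho> (\<kappa> b)"] that unfolding Max by force
      obtain F m where Fm: "a = (F, m)"
        by (cases a)
      obtain f where f: "f \<in> F" "\<phi> (\<kappa> (F, m)) = Some f" "(F, m) \<in> koszul_basis q ed i j"
        using a(1) by (auto simp: U_def Fm)
      \<comment> \<open>The row of the lower partner \<open>b\<close> isolates \<open>a\<close>: by
        maximality of the rank, any other column of the support that is nonzero in this row lies in
        the class of \<open>a\<close>, so it has the same pivot and must be \<open>a\<close>
        itself.\<close>
      define b where "b = (F - {f}, m + edge_vec ed f)"
      have \<kappa>b: "\<kappa> b = \<kappa> a"
        unfolding b_def Fm by (rule down[OF f(3,2,1)])
      have b: "b \<in> koszul_basis q ed (i - 1) j"
        unfolding b_def by (rule koszul_basis_face[OF f(3,1)])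
      have other: "w a' * koszul_coef ed b a' = 0" if a': "a' \<in> U i - {a}" for a'
      proof (rule ccontr)
        assume nz: "w a' * koszul_coef ed b a' \<noteq> 0"
        obtain F' m' where Fm': "a' = (F', m')"
          by (cases a')
        obtain g where g: "g \<in> F'" "F - {f} = F' - {g}" "m + edge_vec ed f = m' + edge_vec ed g"
          using nz koszul_coef_nonzero unfolding b_def Fm' by (metis mult_zero_right)
        have a'b: "(F', m') \<in> koszul_basis q ed i j"
          using a' by (auto simp: U_def Fm')
        have beq: "b = (F' - {g}, m' + edge_vec ed g)"
          using g by (simp add: b_def)
        have "\<kappa> b = \<kappa> a' \<or> \<rho> (\<kappa> b) < \<rho> (\<kappa> a')"
          using face[OF a'b g(1)] by (simp add: beq Fm')
        moreover have "\<rho> (\<kappa> a') \<le> \<rho> (\<kappa> a)"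
          using max nz a' by auto
        ultimately have "\<kappa> a' = \<kappa> a"
          using \<kappa>b by auto
        then have "f \<in> F'"
          using a' f(2) by (auto simp: U_def Fm' Fm)
        then have "g = f"
          using g by auto
        then have "a' = a"
          using g f(1) by (auto simp: Fm Fm')
        then show False
          using a' by simp
      qed
      have "(\<Sum>a'\<in>U i. w a' * koszul_coef ed b a') = w a * koszul_coef ed b a"
        using sum.remove[OF fin_U a(1), of "\<lambda>a'. w a' * koszul_coef ed b a'"]
          sum.neutral[of "U i - {a}" "\<lambda>a'. w a' * koszul_coef ed b a'"] other by auto
      then have "w a * koszul_coef ed b a = 0"
        using rel b by simp
      moreover have "koszul_coef ed b a \<noteq> (0 :: 'k)"
        unfolding b_def Fm koszul_coef_face[OF f(1)] by simp
      ultimately show False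
        using a(2) by simp
    qed
  qed
  let ?B = "koszul_basis q ed i0 j"
  \<comment> \<open>Sends each lower cell to its upper partner. Injectivity gives
    \<open>card ?B\<close> at most \<open>card (U i0) + card (U (i0 + 1))\<close>, and both numbers
    are lower bounds for ranks; the truncated subtraction in \<open>betti\<close> then yields
    0.\<close>
  define t where "t a = (let f = the (\<phi> (\<kappa> a)) in (insert f (fst a),
      SOME m'. (insert f (fst a), m') \<in> koszul_basis q ed (i0 + 1) j \<and> snd a = m' + edge_vec ed f
        \<and> \<kappa> (insert f (fst a), m') = \<kappa> a))" for a
  have t: "\<exists>f m'. t (F, m) = (insert f F, m') \<and> f \<notin> F \<and> \<phi> (\<kappa> (F, m)) = Some f \<and>
      (insert f F, m') \<in> koszul_basis q ed (i0 + 1) j \<and> m = m' + edge_vec ed f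
      \<and> \<kappa> (insert f F, m') = \<kappa> (F, m)"
    if "(F, m) \<in> ?B - U i0" for F m
  proof -
    have 1: "(F, m) \<in> ?B"
      using that by auto
    obtain f where f: "\<phi> (\<kappa> (F, m)) = Some f"
      using matched[OF 1] by auto
    have 2: "f \<notin> F"
      using that f by (auto simp: U_def)
    show ?thesis
      using someI_ex[OF up[OF 1 f 2]] f 2 by (auto simp: t_def Let_def)
  qed
  have "inj_on t (?B - U i0)"
  proof (rule inj_onI)
    fix a b assume ab: "a \<in> ?B - U i0" "b \<in> ?B - U i0" "t a = t b"
    obtain F m G l where eq: "a = (F, m)" "b = (G, l)"
      by (metis surj_pair)
    show "a = b"
      using t[of F m] t[of G l] ab unfolding eq by (metis Diff_insert_absorb option.inject prod.inject)
  qed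
  moreover have "t ` (?B - U i0) \<subseteq> U (i0 + 1)"
    using t by (force simp: U_def)
  ultimately have "card (?B - U i0) \<le> card (U (i0 + 1))"
    using fin_U by (rule card_inj_on_le)
  moreover have "card (?B - U i0) = card ?B - card (U i0)"
    using U_sub fin_U by (intro card_Diff_subset) auto
  moreover have "card (U i0) \<le> mat_rank (koszul_basis q ed (i0 - 1) j) ?B (koszul_coef ed :: _ \<Rightarrow> _ \<Rightarrow> 'k)"
    by (intro mat_rank_ge finite_koszul_basis U_sub indep)
  moreover have "card (U (i0 + 1)) \<le> mat_rank ?B (koszul_basis q ed (i0 + 1) j) (koszul_coef ed :: _ \<Rightarrow> _ \<Rightarrow> 'k)"
    using indep[of "i0 + 1"] by (intro mat_rank_ge finite_koszul_basis U_sub) simp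
  ultimately show ?thesis
    unfolding betti_def by linarith
qed

section \<open>Linear algebra for nonvanishing homology\<close>

lemma cols_indep_card_le:
  fixes M :: "'b \<Rightarrow> 'a \<Rightarrow> 'k :: field"
  assumes "finite B" "finite A" "cols_indep B M A"
  shows "card A \<le> card B"
  using assms
proof (induction B arbitrary: M A rule: finite_induct)
  case empty
  have "(1 :: 'k) = 0" if "a \<in> A" for a
    using empty(2) that unfolding cols_indep_def by (auto dest: spec[of _ "\<lambda>_. 1"])
  then have "A = {}"
    by auto
  then show ?case
    by simp
next
  case (insert b B)
  show ?case
  proof (cases "\<forall>a\<in>A. M b a = 0")
    case True
    then have "cols_indep B M A"
      using insert.prems(2) by (auto simp: cols_indep_def)
    then show ?thesis
      using insert.IH[OF insert.prems(1)] insert.hyps by fastforce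
  next
    case False
    then obtain a0 where a0: "a0 \<in> A" "M b a0 \<noteq> 0"
      by blast
    \<comment> \<open>Gaussian elimination with pivot \<open>a0\<close> in row \<open>b\<close>. A
      relation \<open>w\<close> among the new columns extends to a relation \<open>v\<close> of the
      old ones, the coefficient at \<open>a0\<close> being the one that makes row \<open>b\<close>
      vanish.\<close>
    define M' where "M' b' a = M b' a - M b a / M b a0 * M b' a0" for b' a
    have "cols_indep B M' (A - {a0})"
      unfolding cols_indep_def
    proof (intro allI impI ballI)
      fix w a assume w: "\<forall>b\<in>B. (\<Sum>a\<in>A - {a0}. w a * M' b a) = 0" and a: "a \<in> A - {a0}"
      define v where "v a = (if a = a0 then - (\<Sum>a\<in>A - {a0}. w a * M b a) / M b a0 else w a)" for a
      have split: "(\<Sum>a\<in>A. v a * M b' a) = v a0 * M b' a0 + (\<Sum>a\<in>A - {a0}. w a * M b' a)" for b'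
        using sum.remove[OF insert.prems(1) a0(1), of "\<lambda>a. v a * M b' a"] by (simp add: v_def)
      have "(\<Sum>a\<in>A. v a * M b a) = 0"
        unfolding split using a0(2) by (simp add: v_def)
      moreover have "(\<Sum>a\<in>A. v a * M b' a) = 0" if "b' \<in> B" for b'
      proof -
        have "(\<Sum>a\<in>A - {a0}. w a * M' b' a)
            = (\<Sum>a\<in>A - {a0}. w a * M b' a) - (\<Sum>a\<in>A - {a0}. w a * M b a) / M b a0 * M b' a0"
          by (simp add: M'_def algebra_simps sum_subtractf sum_divide_distrib sum_distrib_left)
        then show ?thesis
          unfolding split using w that by (simp add: v_def)
      qed
      ultimately have "\<forall>a\<in>A. v a = 0"
        using insert.prems(2) unfolding cols_indep_def by blast
      then show "w a = 0"
        using a by (auto simp: v_def split: if_splits)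
    qed
    then have "card (A - {a0}) \<le> card B"
      using insert.IH insert.prems(1) by simp
    then show ?thesis
      using a0(1) insert.prems(1) insert.hyps by (simp add: card_Diff_singleton)
  qed
qed

text \<open>\<open>z\<close> is a cycle and \<open>l\<close> vanishes on all boundaries, so
  \<open>l\<close> detects a nonzero homology class of \<open>z\<close>. In terms of ranks: the unit
  vectors at a maximal independent set of columns of \<open>M\<^sub>1\<close>, the vector
  \<open>z\<close>, and a maximal independent set of columns of \<open>M\<^sub>2\<close> are jointly
  independent.\<close>

lemma rank_sum_less:
  fixes M\<^sub>1 :: "'c \<Rightarrow> 'b \<Rightarrow> 'k :: field" and M\<^sub>2 :: "'b \<Rightarrow> 'a \<Rightarrow> 'k" and l z :: "'b \<Rightarrow> 'k"
  assumes fin: "finite X" "finite Z"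
    and comp: "\<And>y a. y \<in> Y \<Longrightarrow> a \<in> Z \<Longrightarrow> (\<Sum>x\<in>X. M\<^sub>1 y x * M\<^sub>2 x a) = 0"
    and l: "\<And>a. a \<in> Z \<Longrightarrow> (\<Sum>x\<in>X. l x * M\<^sub>2 x a) = 0"
    and z: "\<And>y. y \<in> Y \<Longrightarrow> (\<Sum>x\<in>X. M\<^sub>1 y x * z x) = 0"
    and lz: "(\<Sum>x\<in>X. l x * z x) \<noteq> 0"
  shows "mat_rank Y X M\<^sub>1 + mat_rank X Z M\<^sub>2 < card X"
proof -
  obtain S\<^sub>1 where S\<^sub>1: "S\<^sub>1 \<subseteq> X" "cols_indep Y M\<^sub>1 S\<^sub>1" "card S\<^sub>1 = mat_rank Y X M\<^sub>1"
    using fin(1) by (rule mat_rank_attained)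
  obtain S\<^sub>2 where S\<^sub>2: "S\<^sub>2 \<subseteq> Z" "cols_indep X M\<^sub>2 S\<^sub>2" "card S\<^sub>2 = mat_rank X Z M\<^sub>2"
    using fin(2) by (rule mat_rank_attained)
  have fS: "finite S\<^sub>1" "finite S\<^sub>2"
    using S\<^sub>1(1) S\<^sub>2(1) fin finite_subset by blast+
  \<comment> \<open>\<open>Inl\<close> indexes the unit vectors, \<open>Inr None\<close> the vector
    \<open>z\<close>, and \<open>Inr (Some a)\<close> the columns of
    \<open>M\<^sub>2\<close>.\<close>
  define C where "C = Inl ` S\<^sub>1 \<union> Inr ` insert None (Some ` S\<^sub>2)"
  define M where "M x c = (case c of Inl a \<Rightarrow> if x = a then 1 else 0
      | Inr None \<Rightarrow> z x | Inr (Some a) \<Rightarrow> M\<^sub>2 x a)" for x c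
  have sum_C: "sum f C = (\<Sum>a\<in>S\<^sub>1. f (Inl a)) + (f (Inr None) + (\<Sum>a\<in>S\<^sub>2. f (Inr (Some a))))" for f :: "_ \<Rightarrow> 'k"
  proof -
    have "sum f (Inr ` insert None (Some ` S\<^sub>2)) = sum (f \<circ> Inr) (insert None (Some ` S\<^sub>2))"
      by (rule sum.reindex) (simp add: inj_on_def)
    also have "\<dots> = f (Inr None) + (\<Sum>a\<in>Some ` S\<^sub>2. f (Inr a))"
      using fS by (subst sum.insert) auto
    also have "(\<Sum>a\<in>Some ` S\<^sub>2. f (Inr a)) = (\<Sum>a\<in>S\<^sub>2. f (Inr (Some a)))"
      by (subst sum.reindex) auto
    finally have 1: "sum f (Inr ` insert None (Some ` S\<^sub>2)) = f (Inr None) + (\<Sum>a\<in>S\<^sub>2. f (Inr (Some a)))" .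
    have 2: "sum f (Inl ` S\<^sub>1) = (\<Sum>a\<in>S\<^sub>1. f (Inl a))"
      by (subst sum.reindex) auto
    show ?thesis
      unfolding C_def using fS 1 2 by (subst sum.union_disjoint) auto
  qed
  have card_C: "card C = card S\<^sub>1 + (1 + card S\<^sub>2)"
  proof -
    have "card (Inr ` insert None (Some ` S\<^sub>2) :: ('b + 'a option) set) = card (insert None (Some ` S\<^sub>2))"
      by (rule card_image) (simp add: inj_on_def)
    also have "\<dots> = 1 + card S\<^sub>2"
      using fS by (subst card_insert_disjoint) (auto simp: card_image)
    finally have "card (Inr ` insert None (Some ` S\<^sub>2) :: ('b + 'a option) set) = 1 + card S\<^sub>2" .
    moreover have "card (Inl ` S\<^sub>1 :: ('b + 'a option) set) = card S\<^sub>1"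
      by (rule card_image) (simp add: inj_on_def)
    ultimately show ?thesis
      unfolding C_def using fS by (subst card_Un_disjoint) auto
  qed
  have "cols_indep X M C"
    unfolding cols_indep_def
  proof (rule allI, rule impI)
    fix w assume "\<forall>x\<in>X. (\<Sum>c\<in>C. w c * M x c) = 0"
    then have w: "(if x \<in> S\<^sub>1 then w (Inl x) else 0) + (w (Inr None) * z x + (\<Sum>a\<in>S\<^sub>2. w (Inr (Some a)) * M\<^sub>2 x a)) = 0"
      if "x \<in> X" for x
      using that fS(1) by (simp add: sum_C M_def if_distrib[of "\<lambda>x. _ * x"] cong: if_cong)
    \<comment> \<open>A functional \<open>g\<close> that kills the columns of
      \<open>M\<^sub>2\<close> removes them from the relation. The rows of \<open>M\<^sub>1\<close>
      then eliminate the unit vectors, \<open>l\<close> eliminates \<open>z\<close>, and what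
      remains is a relation among the columns in \<open>S\<^sub>2\<close>.\<close>
    have test: "(\<Sum>a\<in>S\<^sub>1. w (Inl a) * g a) + w (Inr None) * (\<Sum>x\<in>X. g x * z x) = 0"
      if g: "\<And>a. a \<in> Z \<Longrightarrow> (\<Sum>x\<in>X. g x * M\<^sub>2 x a) = 0" for g :: "'b \<Rightarrow> 'k"
    proof -
      have "0 = (\<Sum>x\<in>X. g x * ((if x \<in> S\<^sub>1 then w (Inl x) else 0) +
          (w (Inr None) * z x + (\<Sum>a\<in>S\<^sub>2. w (Inr (Some a)) * M\<^sub>2 x a))))"
        using w by simp
      also have "\<dots> = (\<Sum>x\<in>X. if x \<in> S\<^sub>1 then w (Inl x) * g x else 0) + w (Inr None) * (\<Sum>x\<in>X. g x * z x)
          + (\<Sum>x\<in>X. \<Sum>a\<in>S\<^sub>2. w (Inr (Some a)) * (g x * M\<^sub>2 x a))"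
        by (simp add: distrib_left sum.distrib sum_distrib_left mult_ac if_distrib[of "\<lambda>x. _ * x"] cong: if_cong)
      also have "(\<Sum>x\<in>X. \<Sum>a\<in>S\<^sub>2. w (Inr (Some a)) * (g x * M\<^sub>2 x a))
          = (\<Sum>a\<in>S\<^sub>2. w (Inr (Some a)) * (\<Sum>x\<in>X. g x * M\<^sub>2 x a))"
        by (subst sum.swap) (simp add: sum_distrib_left)
      also have "\<dots> = 0"
        using g S\<^sub>2(1) by (intro sum.neutral) auto
      also have "(\<Sum>x\<in>X. if x \<in> S\<^sub>1 then w (Inl x) * g x else 0) = (\<Sum>a\<in>S\<^sub>1. w (Inl a) * g a)"
        using fin(1) S\<^sub>1(1) by (simp add: sum.inter_restrict[symmetric] Int_absorb1)
      finally show ?thesis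
        by simp
    qed
    have "(\<Sum>a\<in>S\<^sub>1. w (Inl a) * M\<^sub>1 y a) = 0" if "y \<in> Y" for y
      using test[of "M\<^sub>1 y"] comp[OF that] z[OF that] by simp
    then have 1: "w (Inl a) = 0" if "a \<in> S\<^sub>1" for a
      using S\<^sub>1(2) that unfolding cols_indep_def by (auto dest: spec[of _ "\<lambda>a. w (Inl a)"])
    then have 2: "w (Inr None) = 0"
      using test[of l] l lz by simp
    have "(\<Sum>a\<in>S\<^sub>2. w (Inr (Some a)) * M\<^sub>2 x a) = 0" if "x \<in> X" for x
      using w[OF that] 1 2 by (simp split: if_splits)
    then have 3: "w (Inr (Some a)) = 0" if "a \<in> S\<^sub>2" for a
      using S\<^sub>2(2) that unfolding cols_indep_def by (auto dest: spec[of _ "\<lambda>a. w (Inr (Some a))"])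
    show "\<forall>c\<in>C. w c = 0"
      using 1 2 3 by (auto simp: C_def)
  qed
  then have "card C \<le> card X"
    by (rule cols_indep_card_le[OF fin(1), rotated]) (use fS in \<open>simp add: C_def\<close>)
  then show ?thesis
    using S\<^sub>1(3) S\<^sub>2(3) card_C by simp
qed

lemma koszul_coef_to_empty:
  "koszul_coef ed ({}, l) ({f}, m) = (if l = m + edge_vec ed f then 1 else 0 :: 'k :: field)"
proof -
  have *: "{g. g = f \<and> g < f} = {}"
    by auto
  show ?thesis
    by (auto simp: koszul_coef_def Let_def fun_eq_iff *)
qed

text \<open>Evaluates a functional \<open>g\<close> on the boundary of a cell of homological degree
  2. With \<open>g\<close> a row of the next differential this gives \<open>d d = 0\<close>; with
  the functional of \<open>betti_generator\<close> it gives the vanishing on boundaries.\<close>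

lemma koszul_coef_pair_sum:
  fixes g :: "_ \<Rightarrow> 'k :: field"
  assumes "({x, y}, m) \<in> koszul_basis q ed 2 j" "x < y"
  shows "(\<Sum>a\<in>koszul_basis q ed 1 j. g a * koszul_coef ed a ({x, y}, m))
    = g ({y}, m + edge_vec ed x) - g ({x}, m + edge_vec ed y)"
proof -
  let ?a = "({y}, m + edge_vec ed x)" and ?b = "({x}, m + edge_vec ed y)"
  have ab: "?a = ({x, y} - {x}, m + edge_vec ed x)" "?b = ({x, y} - {y}, m + edge_vec ed y)"
    using assms(2) by auto
  have "{?a, ?b} \<subseteq> koszul_basis q ed 1 j"
    using koszul_basis_face[OF assms(1), of x] koszul_basis_face[OF assms(1), of y] unfolding ab by simp
  moreover have "g a * koszul_coef ed a ({x, y}, m) = 0" if a: "a \<notin> {?a, ?b}" for a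
  proof (rule ccontr)
    assume nz: "g a * koszul_coef ed a ({x, y}, m) \<noteq> 0"
    obtain G l where Gl: "a = (G, l)"
      by (cases a)
    then obtain h where "h \<in> {x, y}" "G = {x, y} - {h}" "l = m + edge_vec ed h"
      using koszul_coef_nonzero[of ed G l "{x, y}" m] nz by auto
    then show False
      using a assms(2) unfolding Gl by auto
  qed
  ultimately have "(\<Sum>a\<in>koszul_basis q ed 1 j. g a * koszul_coef ed a ({x, y}, m))
      = (\<Sum>a\<in>{?a, ?b}. g a * koszul_coef ed a ({x, y}, m))"
    by (intro sum.mono_neutral_right finite_koszul_basis) auto
  also have "\<dots> = g ?a * koszul_coef ed ?a ({x, y}, m) + g ?b * koszul_coef ed ?b ({x, y}, m)"
    using assms(2) by simp
  also have "koszul_coef ed ?a ({x, y}, m) = (1 :: 'k)"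
  proof -
    have *: "{z \<in> {x, y}. z < x} = {}"
      using assms(2) by auto
    show ?thesis
      unfolding ab by (subst koszul_coef_face) (simp, simp only: *, simp)
  qed
  also have "koszul_coef ed ?b ({x, y}, m) = (- 1 :: 'k)"
  proof -
    have *: "{z \<in> {x, y}. z < y} = {x}"
      using assms(2) by auto
    show ?thesis
      unfolding ab by (subst koszul_coef_face) (simp, simp only: *, simp)
  qed
  finally show ?thesis
    by (simp only: mult_1_right mult_minus1_right add_uminus_conv_diff)
qed

lemma koszul_basis_pairE:
  assumes "a \<in> koszul_basis q ed 2 j"
  obtains x y m where "a = ({x, y}, m)" "x < y" "y < q" "m \<in> edge_monos q ed (j - 2)"
proof -
  obtain F m where a: "a = (F, m)" "F \<subseteq> {..<q}" "card F = 2" "m \<in> edge_monos q ed (j - 2)"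
    using assms by (auto simp: koszul_basis_def)
  obtain x y where xy: "F = {x, y}" "x \<noteq> y"
    using a(3) by (auto simp: card_2_iff)
  show ?thesis
  proof (cases "x < y")
    case True
    then show ?thesis using that[of x y m] a xy by auto
  next
    case False
    then show ?thesis using that[of y x m] a xy by auto
  qed
qed

section \<open>Counting monomials\<close>

lemma set_exp_remove: "g \<in> F \<Longrightarrow> set_exp F = set_exp (F - {g}) + unit_exp g"
  by (auto simp: set_exp_def unit_exp_def fun_eq_iff)

lemma unit_exp_remove: "0 < u f \<Longrightarrow> u = u - unit_exp f + unit_exp f"
  by (auto simp: unit_exp_def fun_eq_iff)

definition count_series :: "(nat \<Rightarrow> 'a set) \<Rightarrow> int fps" where
  "count_series M = Abs_fps (\<lambda>d. int (card (M d)))"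

text \<open>The counting form of a short exact sequence: \<open>f\<close> stands for multiplication
  by a monomial of degree \<open>n\<close>, and \<open>L\<close> for the cokernel. Degrees below
  \<open>n\<close> receive nothing from \<open>f\<close> and need the separate hypothesis
  \<open>low\<close>.\<close>

lemma count_series_split:
  assumes "\<And>d. finite (K d)" "\<And>d. finite (L d)" "\<And>d. inj_on f (K d)"
    and low: "\<And>d. d < n \<Longrightarrow> M d = L d"
    and high: "\<And>d. M (d + n) = f ` K d \<union> L (d + n)" "\<And>d. f ` K d \<inter> L (d + n) = {}"
  shows "count_series M = fps_X ^ n * count_series K + count_series L"
proof (rule fps_ext)
  fix d
  show "fps_nth (count_series M) d = fps_nth (fps_X ^ n * count_series K + count_series L) d"
  proof (cases "d < n")
    case True
    then show ?thesis
      by (simp add: count_series_def fps_X_power_mult_nth low)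
  next
    case False
    then have d: "d = (d - n) + n"
      by simp
    have "card (M d) = card (f ` K (d - n)) + card (L d)"
      using high[of "d - n"] assms(1,2) by (subst card_Un_disjoint[symmetric]) (auto simp flip: d)
    also have "card (f ` K (d - n)) = card (K (d - n))"
      by (rule card_image) (rule assms(3))
    finally show ?thesis
      using False by (simp add: count_series_def fps_X_power_mult_nth)
  qed
qed

lemma monos_on_add:
  assumes "u \<in> monos_on R d" "v \<in> monos_on R d'"
  shows "u + v \<in> monos_on R (d + d')"
  using assms by (auto simp: monos_on_def sum.distrib)

lemma monos_on_diff:
  assumes "u \<in> monos_on R (d + d')" "v \<in> monos_on R d'" "\<And>x. v x \<le> u x"
  shows "u - v \<in> monos_on R d" "u = u - v + v"
proof -
  show eq: "u = u - v + v"
    using assms(3) by (auto simp: fun_eq_iff)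
  have "sum (\<lambda>x. (u - v + v) x) R = sum (u - v) R + sum v R"
    by (simp add: sum.distrib)
  then show "u - v \<in> monos_on R d"
    using assms(1,2) eq by (auto simp: monos_on_def)
qed

lemma unit_exp_in_monos_on: "finite R \<Longrightarrow> v \<in> R \<Longrightarrow> unit_exp v \<in> monos_on R 1"
  by (auto simp: monos_on_def unit_exp_def)

lemma set_exp_in_monos_on:
  assumes "finite R" "B \<subseteq> R"
  shows "set_exp B \<in> monos_on R (card B)"
  using assms by (auto simp: monos_on_def set_exp_def sum.If_cases Int_absorb1)

lemma count_series_monos_on:
  assumes "finite R"
  shows "count_series (monos_on R) * (1 - fps_X) ^ card R = 1"
  using assms
proof (induction R rule: finite_induct)
  case empty
  have "monos_on {} d = (if d = 0 then {\<lambda>_. 0} else {})" for d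
    by (auto simp: monos_on_def fun_eq_iff)
  then have "count_series (monos_on {}) = 1"
    by (auto simp: count_series_def fps_eq_iff fps_one_def)
  then show ?case
    by simp
next
  case (insert v R)
  let ?R = "insert v R"
  have fin: "finite ?R"
    using insert.hyps by simp
  have sub: "u \<in> monos_on R d \<longleftrightarrow> u \<in> monos_on ?R d \<and> u v = 0" for u d
    using insert.hyps by (auto simp: monos_on_def) metis
  have "count_series (monos_on ?R) = fps_X ^ 1 * count_series (monos_on ?R) + count_series (monos_on R)"
  proof (rule count_series_split[where f = "\<lambda>u. u + unit_exp v"])
    show "inj_on (\<lambda>u. u + unit_exp v) (monos_on ?R d)" for d
      by (simp add: inj_on_def)
    show "monos_on ?R d = monos_on R d" if "d < 1" for d
      using that insert.hyps by (auto simp: monos_on_def) metis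
    show "monos_on ?R (d + 1) = (\<lambda>u. u + unit_exp v) ` monos_on ?R d \<union> monos_on R (d + 1)" for d
    proof (intro equalityI subsetI)
      fix u assume u: "u \<in> monos_on ?R (d + 1)"
      show "u \<in> (\<lambda>u. u + unit_exp v) ` monos_on ?R d \<union> monos_on R (d + 1)"
      proof (cases "u v = 0")
        case True
        then show ?thesis
          using u sub by blast
      next
        case False
        then have "unit_exp v x \<le> u x" for x
          by (simp add: unit_exp_def)
        from monos_on_diff[OF u unit_exp_in_monos_on[OF fin] this]
        show ?thesis
          by blast
      qed
    next
      fix u assume "u \<in> (\<lambda>u. u + unit_exp v) ` monos_on ?R d \<union> monos_on R (d + 1)"
      then show "u \<in> monos_on ?R (d + 1)"
        using monos_on_add[OF _ unit_exp_in_monos_on[OF fin]] sub by auto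
    qed
    show "(\<lambda>u. u + unit_exp v) ` monos_on ?R d \<inter> monos_on R (d + 1) = {}" for d
      using sub by (auto simp: unit_exp_def)
  qed (use insert.hyps finite_monos_on in auto)
  then have "count_series (monos_on ?R) * (1 - fps_X) = count_series (monos_on R)"
    by (simp add: algebra_simps)
  then show ?case
    using insert by (simp add: mult.assoc[symmetric])
qed

section \<open>The numerator of the Hilbert series\<close>

definition h_step :: "nat \<Rightarrow> int poly" where
  "h_step N = (\<Sum>i<N. monom 1 (Suc i))"

text \<open>The numerator over \<open>(1 - x)^(2 * N + l)\<close> when \<open>l\<close> path
  vertices are left. A further vertex \<open>z_j\<close> contributes the multiples of
  \<open>s_j\<close> that \<open>B\<close> does not divide, giving \<open>h_step N\<close>, that is
  \<open>x (1 - x^N) / (1 - x)\<close>, and the multiples of \<open>B s_j\<close>, whose series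
  \<open>x^(N+1) / (1 - x)^(2 * N)\<close> has a pole of fixed order and so keeps the factor
  \<open>(1 - x)^l\<close>.\<close>

primrec h_poly :: "nat \<Rightarrow> nat \<Rightarrow> int poly" where
  "h_poly N 0 = 1"
| "h_poly N (Suc l) = h_poly N l + h_step N + monom 1 (Suc N) * [:1, - 1:] ^ l"

text \<open>The term added last has strictly larger degree than all others, so nothing cancels. The
  formula starts at \<open>Suc l\<close> because \<open>h_poly N 0\<close> is constant.\<close>

lemma degree_h_poly: "degree (h_poly N (Suc l)) = Suc N + l"
proof (induction l)
  case (Suc l)
  let ?t = "\<lambda>l. monom 1 (Suc N) * [:1, - 1:] ^ l :: int poly"
  have "degree (h_step N) \<le> N"
    unfolding h_step_def by (intro degree_sum_le) (auto intro: order.trans[OF degree_monom_le])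
  then have "degree (h_poly N (Suc l) + h_step N) \<le> Suc N + l"
    using Suc by (intro degree_add_le) auto
  moreover have "degree (?t (Suc l)) = Suc N + Suc l"
    by (subst degree_mult_eq) (auto simp: degree_monom_eq degree_power_eq simp del: power_Suc)
  ultimately show ?case
    by (subst h_poly.simps(2), subst degree_add_eq_right) auto
next
  case 0
  have "degree (h_step N) \<le> N"
    unfolding h_step_def by (intro degree_sum_le) (auto intro: order.trans[OF degree_monom_le])
  then have "degree (1 + h_step N) \<le> N"
    by (intro degree_add_le) auto
  then show ?case
    by (simp, subst degree_add_eq_right) (auto simp: degree_monom_eq)
qed

lemma poly_h_poly_pos: "0 < poly (h_poly N l) 1"
proof (induction l)
  case (Suc l)
  have "poly (h_step N) 1 \<ge> 0"
    by (simp add: h_step_def poly_sum poly_monom)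
  moreover have "(0 :: int) \<le> 0 ^ l"
    by simp
  ultimately show ?case
    using Suc by (simp add: poly_monom del: zero_le_power)
qed simp

lemma fps_of_poly_one_minus_X: "fps_of_poly [:1, - 1 :: int:] = 1 - fps_X"
  by (auto simp: fps_eq_iff coeff_pCons fps_X_def split: nat.splits)

lemma fps_of_poly_h_step: "fps_of_poly (h_step N) * (1 - fps_X) = fps_X * (1 - fps_X ^ N)"
proof -
  have "fps_of_poly (h_step N) = fps_X * (\<Sum>i<N. fps_X ^ i)"
    by (simp add: h_step_def fps_of_poly_sum fps_of_poly_monom sum_distrib_left)
  then show ?thesis
    by (simp add: one_diff_power_eq[of "fps_X :: int fps" N] mult_ac)
qed

section \<open>Semigroups with the fibres of the edge semigroup\<close>

text \<open>
  The indices \<open>2N + j\<close> and \<open>2N + k + j\<close> stand for \<open>p_j\<close> and \<open>s_j\<close>. The fibre condition says that the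
  toric ideal is generated by the binomials above: the integer \<open>n\<close> counts how often \<open>p_i p_j A\<close> is
  replaced by \<open>s_i s_j B\<close>.
\<close>

locale cycle_pair_fibres =
  fixes q k N :: nat and ed :: "nat \<Rightarrow> nat set" and A B :: "nat set"
  assumes q_eq: "q = 2 * N + 2 * k"
    and AB: "A \<union> B = {..<2 * N}" "A \<inter> B = {}" "card A = N" "card B = N"
    and val_eq_iff: "\<And>c c'. edge_val q ed c = edge_val q ed c' \<longleftrightarrow>
      (\<exists>n :: int. (\<forall>j<k. c (2 * N + j) + c (2 * N + k + j) = c' (2 * N + j) + c' (2 * N + k + j)) \<and>
        (\<Sum>j<k. int (c' (2 * N + k + j))) = (\<Sum>j<k. int (c (2 * N + k + j))) + 2 * n \<and>
        (\<forall>b\<in>B. int (c' b) = int (c b) + n) \<and> (\<forall>a\<in>A. int (c' a) = int (c a) - n))"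
begin

abbreviation "val \<equiv> edge_val q ed"
abbreviation "e \<equiv> edge_vec ed"
abbreviation p :: "nat \<Rightarrow> nat" where "p j \<equiv> 2 * N + j"
abbreviation s :: "nat \<Rightarrow> nat" where "s j \<equiv> 2 * N + k + j"

definition p_free :: "(nat \<Rightarrow> nat) \<Rightarrow> bool" where
  "p_free u \<longleftrightarrow> (\<forall>i. 2 * N \<le> i \<and> i < 2 * N + k \<or> q \<le> i \<longrightarrow> u i = 0)"

lemma p_freeI:
  assumes "\<And>j. j < k \<Longrightarrow> u (p j) = 0" "\<And>i. q \<le> i \<Longrightarrow> u i = 0"
  shows "p_free u"
  unfolding p_free_def
proof (intro allI impI)
  fix i assume "2 * N \<le> i \<and> i < 2 * N + k \<or> q \<le> i"
  then show "u i = 0"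
    using assms(1)[of "i - 2 * N"] assms(2)[of i] by fastforce
qed

lemma p_freeD: "p_free u \<Longrightarrow> j < k \<Longrightarrow> u (p j) = 0" "p_free u \<Longrightarrow> q \<le> i \<Longrightarrow> u i = 0"
  by (auto simp: p_free_def)

definition divides_by_p :: "nat \<Rightarrow> (nat \<Rightarrow> nat) \<Rightarrow> bool" where
  "divides_by_p j m \<longleftrightarrow> (\<exists>c. m = val c \<and> c (p j) > 0)"

text \<open>Says that \<open>z_j\<close> occurs in \<open>m\<close>. By \<open>meets_val\<close> any
  preimage \<open>c\<close> decides this, whereas \<open>divides_by_p\<close> depends on the choice
  of the preimage.\<close>

definition meets :: "nat \<Rightarrow> (nat \<Rightarrow> nat) \<Rightarrow> bool" where
  "meets j m \<longleftrightarrow> (\<exists>c. m = val c \<and> c (p j) + c (s j) > 0)"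

lemma finite_AB [simp]: "finite A" "finite B"
  using AB(1) by (metis finite_Un finite_lessThan)+

lemma AB_lt: "a \<in> A \<Longrightarrow> a < 2 * N" "b \<in> B \<Longrightarrow> b < 2 * N"
  using AB(1) by auto

lemma index_cases:
  assumes "i < q"
  obtains "i \<in> A" | "i \<in> B" | j where "j < k" "i = p j" | j where "j < k" "i = s j"
proof -
  consider "i < 2 * N" | "2 * N \<le> i" "i < 2 * N + k" | "2 * N + k \<le> i"
    by linarith
  then show ?thesis
  proof cases
    case 1 then show ?thesis using AB(1) that(1,2) by auto
  next
    case 2 then show ?thesis using that(3)[of "i - 2 * N"] by auto
  next
    case 3 then show ?thesis using that(4)[of "i - (2 * N + k)"] assms q_eq by auto
  qed
qed

lemma sum_all: 
  "sum f {..<q} = sum f A + sum f B + (\<Sum>j<k. f (p j)) + (\<Sum>j<k. f (s j))" for f :: "nat \<Rightarrow> 'a :: comm_monoid_add"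
proof -
  have "sum f {..<m + n} = sum f {..<m} + (\<Sum>j<n. f (m + j))" for m n
    by (induction n) (auto simp: add.assoc)
  from this[of "2 * N + k" k] this[of "2 * N" k]
  have "sum f {..<q} = sum f {..<2 * N} + (\<Sum>j<k. f (p j)) + (\<Sum>j<k. f (s j))"
    by (simp add: q_eq mult_2 add.assoc)
  moreover have "sum f {..<2 * N} = sum f A + sum f B"
    unfolding AB(1)[symmetric] by (rule sum.union_disjoint) (use AB(2) in auto)
  ultimately show ?thesis
    by simp
qed

lemma val_eqE:
  assumes "val c = val c'"
  obtains n :: int where "\<And>j. j < k \<Longrightarrow> c (p j) + c (s j) = c' (p j) + c' (s j)"
    "(\<Sum>j<k. int (c' (s j))) = (\<Sum>j<k. int (c (s j))) + 2 * n"
    "\<And>b. b \<in> B \<Longrightarrow> int (c' b) = int (c b) + n" "\<And>a. a \<in> A \<Longrightarrow> int (c' a) = int (c a) - n"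
  using assms unfolding val_eq_iff by blast

lemma val_eq_degree:
  assumes "val c = val c'"
  shows "sum c {..<q} = sum c' {..<q}"
proof -
  obtain n :: int where n: "\<And>j. j < k \<Longrightarrow> c (p j) + c (s j) = c' (p j) + c' (s j)"
    "\<And>b. b \<in> B \<Longrightarrow> int (c' b) = int (c b) + n" "\<And>a. a \<in> A \<Longrightarrow> int (c' a) = int (c a) - n"
    using val_eqE[OF assms] by metis
  have "(\<Sum>j<k. int (c (p j))) + (\<Sum>j<k. int (c (s j))) = (\<Sum>j<k. int (c' (p j))) + (\<Sum>j<k. int (c' (s j)))"
    using n(1) by (simp flip: sum.distrib of_nat_add)
  moreover have "(\<Sum>b\<in>B. int (c' b)) = (\<Sum>b\<in>B. int (c b)) + int N * n"
    using n(2) AB(4) by (simp add: sum.distrib)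
  moreover have "(\<Sum>a\<in>A. int (c' a)) = (\<Sum>a\<in>A. int (c a)) - int N * n"
    using n(3) AB(3) by (simp add: sum_subtractf)
  ultimately have "int (sum c {..<q}) = int (sum c' {..<q})"
    unfolding sum_all by simp
  then show ?thesis
    by (simp only: of_nat_eq_iff)
qed

text \<open>Without the \<open>p_j\<close>, the fibre condition fixes every exponent of an
  \<open>s_j\<close>; the equation for the sum of these exponents then forces \<open>n = 0\<close>.
  So the \<open>s_j\<close> and the cycle edges are algebraically independent in the edge
  ring.\<close>

lemma val_inj_p_free:
  assumes "val c = val c'" "p_free c" "p_free c'"
  shows "c = c'"
proof -
  obtain n :: int where n: "\<And>j. j < k \<Longrightarrow> c (p j) + c (s j) = c' (p j) + c' (s j)"
    "(\<Sum>j<k. int (c' (s j))) = (\<Sum>j<k. int (c (s j))) + 2 * n"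
    "\<And>b. b \<in> B \<Longrightarrow> int (c' b) = int (c b) + n" "\<And>a. a \<in> A \<Longrightarrow> int (c' a) = int (c a) - n"
    using val_eqE[OF assms(1)] by blast
  have s: "c (s j) = c' (s j)" "c (p j) = 0" "c' (p j) = 0" if "j < k" for j
    using n(1)[OF that] assms(2,3) that by (auto simp: p_free_def)
  then have "n = 0"
    using n(2) by simp
  show ?thesis
  proof
    fix i
    show "c i = c' i"
    proof (cases "i < q")
      case True
      then show ?thesis
        by (cases rule: index_cases) (use n(3,4)[of i] \<open>n = 0\<close> s in auto)
    next
      case False
      then show ?thesis
        using assms(2,3) by (auto simp: p_free_def)
    qed
  qed
qed

text \<open>A preimage containing \<open>p_j\<close> has smaller total degree in the
  \<open>s_i\<close>, so \<open>n < 0\<close>: at least one factor \<open>s_i s_l B\<close> has been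
  replaced by \<open>p_i p_l A\<close>, which requires \<open>B\<close> and two factors among the
  \<open>s_i\<close> in \<open>u\<close>.\<close>

lemma p_free_divides:
  assumes "p_free u" "j < k" "divides_by_p j (val u)"
  shows "\<forall>b\<in>B. 0 < u b" "2 \<le> (\<Sum>i<k. u (s i))"
proof -
  obtain c where c: "val u = val c" "c (p j) > 0"
    using assms(3) by (auto simp: divides_by_p_def)
  obtain n :: int where n: "\<And>j. j < k \<Longrightarrow> u (p j) + u (s j) = c (p j) + c (s j)"
    "(\<Sum>j<k. int (c (s j))) = (\<Sum>j<k. int (u (s j))) + 2 * n"
    "\<And>b. b \<in> B \<Longrightarrow> int (c b) = int (u b) + n"
    using val_eqE[OF c(1)] by metis
  have "u (s i) = c (p i) + c (s i)" if "i < k" for i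
    using n(1)[OF that] assms(1) that by (auto simp: p_free_def)
  then have "(\<Sum>j<k. int (u (s j))) = (\<Sum>j<k. int (c (p j))) + (\<Sum>j<k. int (c (s j)))"
    by (simp flip: sum.distrib)
  moreover have "int (c (p j)) \<le> (\<Sum>j<k. int (c (p j)))"
    using assms(2) by (intro member_le_sum) auto
  ultimately have "n < 0"
    using n(2) c(2) by linarith
  have "0 < u b" if "b \<in> B" for b
    using n(3)[OF that] \<open>n < 0\<close> by linarith
  then show "\<forall>b\<in>B. 0 < u b"
    by blast
  have "(\<Sum>j<k. int (c (s j))) \<ge> 0"
    by (intro sum_nonneg) auto
  then have "2 \<le> (\<Sum>i<k. int (u (s i)))"
    using n(2) \<open>n < 0\<close> by linarith
  then show "2 \<le> (\<Sum>i<k. u (s i))"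
    by (simp flip: of_nat_sum)
qed

lemma val_exchange: 
  assumes "i < k" "j < k"
  shows "val (unit_exp (s j) + unit_exp (p i)) = val (unit_exp (p j) + unit_exp (s i))"
  unfolding val_eq_iff
proof (rule exI[of _ 0], intro conjI allI ballI impI)
  fix a assume "a \<in> A"
  then have "a < 2 * N"
    by (rule AB_lt)
  then show "int ((unit_exp (p j) + unit_exp (s i)) a) = int ((unit_exp (s j) + unit_exp (p i)) a) - 0"
    by (simp add: unit_exp_def)
next
  fix b assume "b \<in> B"
  then have "b < 2 * N"
    by (rule AB_lt)
  then show "int ((unit_exp (p j) + unit_exp (s i)) b) = int ((unit_exp (s j) + unit_exp (p i)) b) + 0"
    by (simp add: unit_exp_def)
qed (use assms in \<open>auto simp: unit_exp_def sum.distrib if_distrib[of int] cong: if_cong\<close>)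

lemma val_swap:
  assumes "i < k" "j < k"
  shows "val (unit_exp (s j) + unit_exp (s i) + set_exp B) = val (unit_exp (p j) + unit_exp (p i) + set_exp A)"
proof -
  have out: "s l \<notin> A" "s l \<notin> B" "p l \<notin> A" "p l \<notin> B" for l
    using AB_lt by force+
  show ?thesis
    unfolding val_eq_iff
  \<comment> \<open>The integer of the fibre condition counts replacements of the \<open>A\<close>
    side by the \<open>B\<close> side; here the replacement goes the other way.\<close>
  proof (rule exI[of _ "-1"], intro conjI allI ballI impI)
    fix a assume a: "a \<in> A"
    then have "a < 2 * N" "a \<notin> B"
      using AB_lt AB(2) by auto
    then show "int ((unit_exp (p j) + unit_exp (p i) + set_exp A) a)
        = int ((unit_exp (s j) + unit_exp (s i) + set_exp B) a) - -1"
      using a by (simp add: unit_exp_def set_exp_def)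
  next
    fix b assume b: "b \<in> B"
    then have "b < 2 * N" "b \<notin> A"
      using AB_lt AB(2) by auto
    then show "int ((unit_exp (p j) + unit_exp (p i) + set_exp A) b)
        = int ((unit_exp (s j) + unit_exp (s i) + set_exp B) b) + -1"
      using b by (simp add: unit_exp_def set_exp_def)
  qed (use assms out in \<open>auto simp: unit_exp_def set_exp_def sum.distrib if_distrib[of int] cong: if_cong\<close>)
qed

lemma divides_by_pI1:
  assumes "c (p i) > 0" "c (s j) > 0" "i < k" "j < k"
  shows "divides_by_p j (val c)"
proof -
  define c0 where "c0 = c - unit_exp (s j) - unit_exp (p i)"
  have c: "c = c0 + (unit_exp (s j) + unit_exp (p i))"
    using assms by (auto simp: c0_def fun_eq_iff unit_exp_def)
  have "val c = val (c0 + (unit_exp (p j) + unit_exp (s i)))"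
    unfolding c edge_val_add[of _ _ c0] val_exchange[OF assms(3,4)] ..
  then show ?thesis
    unfolding divides_by_p_def by (intro exI conjI) (auto simp: unit_exp_def)
qed

text \<open>Together with \<open>divides_by_pI1\<close> this gives the monomial relations modulo
  \<open>p_j\<close>: \<open>s_j\<close> is killed by each \<open>p_i\<close> and each
  \<open>B s_i\<close>. One factor \<open>s_j\<close> is set aside before looking for the second
  factor, so that \<open>s_j^2 B\<close> is covered as well.\<close>

lemma divides_by_pI2:
  assumes "\<forall>b\<in>B. 0 < c b" "c (s j) > 0" "2 \<le> (\<Sum>i<k. c (s i))" "j < k"
  shows "divides_by_p j (val c)"
proof -
  have "\<exists>i<k. (c - unit_exp (s j)) (s i) > 0"
  proof (rule ccontr)
    assume "\<not> ?thesis"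
    then have "c (s i) \<le> (if i = j then 1 else 0)" if "i < k" for i
      using that by (force simp: unit_exp_def)
    then have "(\<Sum>i<k. c (s i)) \<le> (\<Sum>i<k. if i = j then 1 else 0)"
      by (intro sum_mono) auto
    then show False
      using assms(3,4) by simp
  qed
  then obtain i where i: "i < k" "(c - unit_exp (s j)) (s i) > 0"
    by blast
  define c0 where "c0 = c - unit_exp (s j) - unit_exp (s i) - set_exp B"
  have c: "c = c0 + (unit_exp (s j) + unit_exp (s i) + set_exp B)"
  proof
    fix x
    have "x \<in> B \<Longrightarrow> x < 2 * N" by (rule AB_lt)
    then show "c x = (c0 + (unit_exp (s j) + unit_exp (s i) + set_exp B)) x"
      using assms i by (auto simp: c0_def unit_exp_def set_exp_def split: if_splits)
  qed
  have "val c = val (c0 + (unit_exp (p j) + unit_exp (p i) + set_exp A))"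
    unfolding c edge_val_add[of _ _ c0] val_swap[OF i(1) assms(4)] ..
  then show ?thesis
    unfolding divides_by_p_def by (intro exI conjI) (auto simp: unit_exp_def)
qed

lemma meets_val: "j < k \<Longrightarrow> meets j (val c) \<longleftrightarrow> c (p j) + c (s j) > 0"
  unfolding meets_def val_eq_iff by auto

lemma meets_add_edge:
  assumes "j < k" "f < q" "m \<in> range val"
  shows "meets j (m + e f) \<longleftrightarrow> meets j m \<or> f = p j \<or> f = s j"
proof -
  obtain c where c: "m = val c"
    using assms by auto
  have "m + e f = val (c + unit_exp f)"
    using assms c by (simp add: edge_val_add edge_val_unit)
  then show ?thesis
    using assms(1) by (auto simp: c meets_val unit_exp_def)
qed

lemma divides_by_p_add:
  assumes "divides_by_p j m" "f < q"
  shows "divides_by_p j (m + e f)"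
proof -
  obtain c where c: "m = val c" "c (p j) > 0"
    using assms by (auto simp: divides_by_p_def)
  have "m + e f = val (c + unit_exp f)"
    using assms c by (simp add: edge_val_add edge_val_unit)
  then show ?thesis
    unfolding divides_by_p_def using c(2) by auto
qed

lemma divides_by_p_add_p:
  assumes "m \<in> range val" "j < k"
  shows "divides_by_p j (m + e (p j))"
proof -
  obtain c where c: "m = val c"
    using assms by auto
  have "m + e (p j) = val (c + unit_exp (p j))"
    using assms c by (simp add: edge_val_add edge_val_unit q_eq)
  then show ?thesis
    unfolding divides_by_p_def by (auto simp: unit_exp_def)
qed

lemma divides_by_p_imp_meets: "divides_by_p j m \<Longrightarrow> meets j m"
  by (auto simp: divides_by_p_def meets_def)

subsection \<open>The matching\<close>

text \<open>
  A cell \<open>(F, m)\<close> is sorted by the first \<open>z_j\<close> which it uses (stage \<open>k\<close> if there is none). Kind 0: \<open>p_j\<close> can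
  be toggled. Otherwise \<open>m\<close> is a unique monomial \<open>u\<close> in the \<open>s_i\<close> and the cycle edges, and kinds 1 and 2 say
  whether \<open>B\<close> divides \<open>u\<close>; stage \<open>k\<close> counts as kind 1. Adding a frozen index of \<open>F\<close> to \<open>m\<close> leaves the
  class. The other indices of \<open>F\<close> together with \<open>u\<close> form a monomial \<open>\<tau>\<close> which is constant on the class, and
  an index in which \<open>\<tau>\<close> exceeds \<open>B s_j\<close> can be toggled without changing the kind.
\<close>

definition stage :: "nat set \<Rightarrow> (nat \<Rightarrow> nat) \<Rightarrow> nat" where
  "stage F m = (LEAST j. k \<le> j \<or> p j \<in> F \<or> meets j m)"

definition kind :: "nat set \<Rightarrow> (nat \<Rightarrow> nat) \<Rightarrow> nat" where
  "kind F m = (let j = stage F m in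
     if k \<le> j then 1
     else if p j \<in> F \<or> divides_by_p j m then 0
     else if \<exists>u. p_free u \<and> m = val u \<and> (\<forall>b\<in>B. 0 < u b) then 1 else 2)"

text \<open>For a nonzero kind, these are the indices whose transfer from \<open>F\<close> to
  \<open>m\<close> always leaves the class: a \<open>p_i\<close> turns into \<open>p_j\<close> by
  exchange with \<open>s_j\<close> or creates an earlier stage; an \<open>s_i\<close> with
  \<open>i < j\<close> creates an earlier stage; and in kind 1 any further \<open>s_i\<close> either
  completes \<open>B s_i s_j\<close>, which \<open>p_j\<close> divides, or, at stage
  \<open>k\<close>, makes \<open>z_i\<close> used.\<close>

definition frozen :: "nat \<Rightarrow> nat \<Rightarrow> nat set" where
  "frozen j t = (if t = 0 then {} else if t = 1 then {2 * N..<q} else {2 * N..<s j})"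

definition cell_class :: "nat set \<times> (nat \<Rightarrow> nat) \<Rightarrow> nat \<times> nat \<times> nat set \<times> (nat \<Rightarrow> nat)" where
  "cell_class = (\<lambda>(F, m). (stage F m, kind F m, F \<inter> frozen (stage F m) (kind F m), m + val (set_exp F)))"

text \<open>The lexicographic order on stage and kind, since the kind is at most 2.\<close>

definition class_rank :: "nat \<times> nat \<times> nat set \<times> (nat \<Rightarrow> nat) \<Rightarrow> nat" where
  "class_rank = (\<lambda>(j, t, _). 3 * j + t)"

text \<open>The exponents of \<open>B s_j\<close>. An index in which \<tau> exceeds them can enter
  or leave \<open>u\<close> without affecting whether \<open>B\<close> or \<open>s_j\<close> divides
  \<open>u\<close>.\<close>

definition threshold :: "nat \<Rightarrow> nat \<Rightarrow> nat" where
  "threshold j = set_exp B + unit_exp (s j)"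

text \<open>Refers to the data of the class only: by \<open>val_inj_p_free\<close>, \<tau> is
  determined by \<sigma> and \<open>Y\<close>. Hence both cells of a pair find the same
  pivot.\<close>

definition pivot_ok :: "nat \<Rightarrow> nat set \<Rightarrow> (nat \<Rightarrow> nat) \<Rightarrow> nat \<Rightarrow> bool" where
  "pivot_ok j Y \<sigma> v \<longleftrightarrow> (\<exists>\<tau>. p_free \<tau> \<and> \<sigma> = val \<tau> + val (set_exp Y) \<and> threshold j v < \<tau> v)"

definition pivot :: "nat \<times> nat \<times> nat set \<times> (nat \<Rightarrow> nat) \<Rightarrow> nat option" where
  "pivot = (\<lambda>(j, t, Y, \<sigma>). if t = 0 then Some (p j)
     else if \<exists>v. pivot_ok j Y \<sigma> v then Some (SOME v. pivot_ok j Y \<sigma> v) else None)"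

text \<open>The normal form of the cells of nonzero kind. In kind 1 before stage \<open>k\<close>,
  the bound on the sum says that \<open>s_j\<close> is the only factor among the \<open>s_i\<close>
  and occurs once; otherwise \<open>p_j\<close> would divide.\<close>

definition reduced_cell :: "nat \<Rightarrow> nat \<Rightarrow> nat set \<Rightarrow> (nat \<Rightarrow> nat) \<Rightarrow> bool" where
  "reduced_cell j t F u \<longleftrightarrow> p_free u \<and> j \<le> k \<and> (\<forall>i<j. u (s i) = 0) \<and> (\<forall>i. i \<le> j \<and> i < k \<longrightarrow> p i \<notin> F) \<and>
     (t = 1 \<and> j = k \<or> j < k \<and> 0 < u (s j) \<and>
        (t = 1 \<and> (\<forall>b\<in>B. 0 < u b) \<and> (\<Sum>i<k. u (s i)) < 2 \<or> t = 2 \<and> \<not> (\<forall>b\<in>B. 0 < u b)))"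

section \<open>Normal forms of cells and their pivots\<close>

lemma stage_le: "stage F m \<le> k"
  unfolding stage_def by (rule Least_le) simp

lemma stage_least: "i < stage F m \<Longrightarrow> p i \<notin> F \<and> \<not> meets i m"
  unfolding stage_def using not_less_Least by blast

lemma stage_holds: "stage F m < k \<Longrightarrow> p (stage F m) \<in> F \<or> meets (stage F m) m"
  using LeastI[of "\<lambda>j. k \<le> j \<or> p j \<in> F \<or> meets j m" k] unfolding stage_def by auto

lemma stage_eqI:
  assumes "j \<le> k" "j < k \<Longrightarrow> p j \<in> F \<or> meets j m" "\<And>i. i < j \<Longrightarrow> p i \<notin> F \<and> \<not> meets i m"
  shows "stage F m = j"
  unfolding stage_def
  by (rule Least_equality) (use assms in \<open>auto simp: not_less[symmetric]\<close>)

lemma kind_0I: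
  assumes "stage F m < k" "p (stage F m) \<in> F \<or> divides_by_p (stage F m) m"
  shows "kind F m = 0"
  using assms by (auto simp: kind_def Let_def)

lemma kind_0D:
  assumes "kind F m = 0"
  shows "stage F m < k" "p (stage F m) \<in> F \<or> divides_by_p (stage F m) m"
  using assms by (auto simp: kind_def Let_def split: if_splits)

lemma kind_le: "kind F m \<le> 2"
  by (simp add: kind_def Let_def)

lemma reduced_cellE:
  assumes "kind F m \<noteq> 0" "m \<in> range val"
  obtains u where "m = val u" "reduced_cell (stage F m) (kind F m) F u"
proof -
  let ?j = "stage F m"
  obtain c' where c': "m = val c'"
    using assms(2) by auto
  \<comment> \<open>A preimage may take arbitrary values from \<open>q\<close> on; truncation is
    needed for \<open>p_free\<close>.\<close>
  define c where "c i = (if i < q then c' i else 0)" for i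
  have c: "m = val c"
    unfolding c' by (rule edge_val_cong) (simp add: c_def)
  have below: "c (p i) = 0" "c (s i) = 0" "p i \<notin> F" if "i < ?j" for i
    using stage_least[OF that] stage_le[of F m] that by (auto simp: c meets_val)
  show thesis
  proof (cases "?j < k")
    case False
    then have j: "?j = k"
      using stage_le[of F m] by simp
    have "p_free c"
      using below(1) j by (intro p_freeI) (auto simp: c_def)
    moreover have "kind F m = 1"
      using j by (simp add: kind_def)
    ultimately show thesis
      using below j by (intro that[OF c]) (auto simp: reduced_cell_def)
  next
    case j: True
    have nd: "p ?j \<notin> F" "\<not> divides_by_p ?j m"
      using kind_0I[OF j] assms(1) by auto
    then have "c (p ?j) = 0"
      using c by (auto simp: divides_by_p_def)
    moreover have "meets ?j m"
      using stage_holds[OF j] nd by auto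
    ultimately have sj: "c (s ?j) > 0"
      using j by (auto simp: c meets_val)
    \<comment> \<open>A factor \<open>p_i\<close> could be exchanged with the factor
      \<open>s_j\<close> to produce \<open>p_j\<close>, which would make the kind 0.\<close>
    have p0: "c (p i) = 0" if "i < k" for i
      using divides_by_pI1[of c i ?j] nd sj that j by (auto simp: c)
    have pf: "p_free c"
      using p0 by (intro p_freeI) (auto simp: c_def)
    have k: "kind F m = (if \<forall>b\<in>B. 0 < c b then 1 else 2)"
      using j nd pf c val_inj_p_free[of _ c] by (auto simp: kind_def Let_def)
    have "\<not> (2 \<le> (\<Sum>i<k. c (s i)))" if "\<forall>b\<in>B. 0 < c b"
      using divides_by_pI2[of c ?j] that sj j nd by (auto simp: c)
    moreover have "p i \<notin> F" if "i \<le> ?j" for i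
      using below(3)[of i] nd that by (cases "i = ?j") auto
    ultimately show thesis
      using pf below(2) sj j stage_le[of F m] by (intro that[OF c]) (auto simp: reduced_cell_def k)
  qed
qed

lemma reduced_cellD:
  assumes "reduced_cell j t F u"
  shows "stage F (val u) = j" "kind F (val u) = t"
proof -
  have p0: "u (p i) = 0" if "i < k" for i
    using assms that by (auto simp: reduced_cell_def p_free_def)
  show stage: "stage F (val u) = j"
    by (rule stage_eqI) (use assms p0 in \<open>auto simp: reduced_cell_def meets_val\<close>)
  show "kind F (val u) = t"
  proof (cases "j < k")
    case False
    then show ?thesis
      using assms by (auto simp: kind_def stage reduced_cell_def)
  next
    case True
    have pf: "p_free u"
      using assms by (auto simp: reduced_cell_def)
    have "\<not> divides_by_p j (val u)"
      using p_free_divides[OF pf True] assms True by (force simp: reduced_cell_def)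
    moreover have "p j \<notin> F"
      using assms True by (auto simp: reduced_cell_def)
    moreover have "(\<exists>u'. p_free u' \<and> val u = val u' \<and> (\<forall>b\<in>B. 0 < u' b)) \<longleftrightarrow> (\<forall>b\<in>B. 0 < u b)"
      using pf val_inj_p_free by metis
    ultimately show ?thesis
      using assms True by (auto simp: kind_def stage reduced_cell_def)
  qed
qed

lemma q_ge: "2 * N + k \<le> q"
  by (simp add: q_eq)

lemma s_lt: "j < k \<Longrightarrow> s j < q"
  by (simp add: q_eq)

lemma s_index:
  assumes "2 * N \<le> i" "i < q" "\<And>l. l < k \<Longrightarrow> i \<noteq> p l"
  obtains l where "l < k" "i = s l"
proof -
  have "2 * N + k \<le> i"
    using assms(1) assms(3)[of "i - 2 * N"] by fastforce
  then show ?thesis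
    using assms(2) that[of "i - (2 * N + k)"] by (simp add: q_eq)
qed

lemma val_set_exp_face:
  assumes "g \<in> F" "g < q"
  shows "m + e g + val (set_exp (F - {g})) = m + val (set_exp F)"
  using assms by (subst (2) set_exp_remove[of g]) (simp_all add: edge_val_add edge_val_unit add_ac)

lemma koszul_basisD:
  assumes "(F, m) \<in> koszul_basis q ed i d"
  shows "F \<subseteq> {..<q}" "finite F" "m \<in> range val"
proof -
  show F: "F \<subseteq> {..<q}" and "m \<in> range val"
    using assms by (auto simp: koszul_basis_def edge_monos_eq)
  show "finite F"
    using F finite_subset by blast
qed

lemma val_in_edge_monos:
  assumes "val u \<in> edge_monos q ed d"
  shows "sum u {..<q} = d"
proof -
  obtain c where c: "val u = val c" "sum c {..<q} = d"
    using assms by (auto simp: edge_monos_eq monos_on_def)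
  show ?thesis
    using val_eq_degree[OF c(1)] c(2) by simp
qed

lemma val_edge_monosI: "val u \<in> edge_monos q ed (sum u {..<q})"
  unfolding edge_monos_def edge_val_def by blast

lemma koszul_basis_insert:
  assumes "(F, val c) \<in> koszul_basis q ed i d" "f \<notin> F" "f < q" "0 < c f"
  shows "(insert f F, val (c - unit_exp f)) \<in> koszul_basis q ed (i + 1) d"
    "val c = val (c - unit_exp f) + e f"
proof -
  have 0: "F \<subseteq> {..<q}" "card F = i" "i \<le> d" "val c \<in> edge_monos q ed (d - i)" "finite F"
    using assms(1) koszul_basisD(2)[OF assms(1)] by (auto simp: koszul_basis_def)
  define c0 where "c0 = c - unit_exp f"
  have c: "c = c0 + unit_exp f"
    unfolding c0_def using assms(4) by (rule unit_exp_remove)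
  have "sum c {..<q} = sum c0 {..<q} + sum (unit_exp f) {..<q}"
    unfolding c by (simp add: sum.distrib)
  moreover have "sum (unit_exp f) {..<q} = 1"
    using assms(3) by (simp add: unit_exp_def)
  ultimately have "sum c0 {..<q} + 1 = d - i"
    using val_in_edge_monos[OF 0(4)] by simp
  then have "sum c0 {..<q} = d - (i + 1)" "i + 1 \<le> d"
    by auto
  then show "(insert f F, val (c - unit_exp f)) \<in> koszul_basis q ed (i + 1) d"
    using val_edge_monosI[of c0] 0 assms(2,3) unfolding c0_def[symmetric] koszul_basis_def by auto
  show "val c = val (c - unit_exp f) + e f"
    unfolding c0_def[symmetric] by (simp add: c edge_val_add edge_val_unit assms(3))
qed

text \<open>Multiplication only adds vertices to \<open>m\<close>; and if \<open>p_j\<close> itself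
  leaves \<open>F\<close>, then \<open>z_j\<close> is met by the new monomial instead.\<close>

lemma stage_face:
  assumes "g \<in> F" "g < q" "m \<in> range val"
  shows "stage (F - {g}) (m + e g) \<le> stage F m"
proof (cases "stage F m < k")
  case False
  then show ?thesis
    using stage_le[of "F - {g}" "m + e g"] by simp
next
  case True
  have "p (stage F m) \<in> F - {g} \<or> meets (stage F m) (m + e g)"
    using stage_holds[OF True] meets_add_edge[OF True assms(2,3)] by auto
  then show ?thesis
    by (subst stage_def) (rule Least_le, simp)
qed

lemma reduced_cell_kind: "reduced_cell j t F u \<Longrightarrow> t \<noteq> 0"
  by (auto simp: reduced_cell_def)

lemma p_free_unfrozen:
  assumes "F \<subseteq> {..<q}" "reduced_cell j t F u"
  shows "p_free (u + set_exp (F - frozen j t))"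
proof (rule p_freeI)
  fix l assume l: "l < k"
  then have "p l \<in> frozen j t"
    using reduced_cell_kind[OF assms(2)] q_ge by (auto simp: frozen_def)
  moreover have "u (p l) = 0"
    using assms(2) l p_freeD by (auto simp: reduced_cell_def)
  ultimately show "(u + set_exp (F - frozen j t)) (p l) = 0"
    by (simp add: set_exp_def)
next
  fix i assume i: "q \<le> i"
  then have "i \<notin> F" "u i = 0"
    using assms p_freeD by (auto simp: reduced_cell_def)
  then show "(u + set_exp (F - frozen j t)) i = 0"
    by (simp add: set_exp_def)
qed

lemma val_unfrozen:
  assumes "F \<subseteq> {..<q}"
  shows "val u + val (set_exp F) = val (u + set_exp (F - X)) + val (set_exp (F \<inter> X))"
proof -
  have "set_exp F = set_exp (F - X) + set_exp (F \<inter> X)"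
    by (auto simp: set_exp_def fun_eq_iff)
  then show ?thesis
    by (simp add: edge_val_add add_ac)
qed

lemma pivot_ok_reduced:
  assumes "F \<subseteq> {..<q}" "reduced_cell j t F u"
  shows "pivot_ok j (F \<inter> frozen j t) (val u + val (set_exp F)) v \<longleftrightarrow>
    threshold j v < (u + set_exp (F - frozen j t)) v" 
proof
  assume "pivot_ok j (F \<inter> frozen j t) (val u + val (set_exp F)) v"
  then obtain \<tau> where \<tau>: "p_free \<tau>" "threshold j v < \<tau> v"
    "val (u + set_exp (F - frozen j t)) + val (set_exp (F \<inter> frozen j t)) = val \<tau> + val (set_exp (F \<inter> frozen j t))"
    unfolding pivot_ok_def val_unfrozen[OF assms(1), of u "frozen j t"] by auto
  then have "val (u + set_exp (F - frozen j t)) = val \<tau>"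
    by (simp only: add_right_cancel)
  then have "u + set_exp (F - frozen j t) = \<tau>"
    using val_inj_p_free p_free_unfrozen[OF assms] \<tau>(1) by blast
  then show "threshold j v < (u + set_exp (F - frozen j t)) v"
    using \<tau>(2) by simp
next
  assume "threshold j v < (u + set_exp (F - frozen j t)) v"
  then show "pivot_ok j (F \<inter> frozen j t) (val u + val (set_exp F)) v"
    unfolding pivot_ok_def val_unfrozen[OF assms(1), of u "frozen j t"]
    using p_free_unfrozen[OF assms] by blast
qed

lemma cell_class_reduced:
  assumes "reduced_cell j t F u"
  shows "cell_class (F, val u) = (j, t, F \<inter> frozen j t, val u + val (set_exp F))"
  by (simp add: cell_class_def reduced_cellD[OF assms])

lemma pivot_reduced:
  assumes "F \<subseteq> {..<q}" "reduced_cell j t F u" "pivot (cell_class (F, val u)) = Some f"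
  shows "threshold j f < (u + set_exp (F - frozen j t)) f"
proof -
  have "pivot_ok j (F \<inter> frozen j t) (val u + val (set_exp F)) f"
    using assms(3) reduced_cell_kind[OF assms(2)]
    by (auto simp: cell_class_reduced[OF assms(2)] pivot_def intro: someI split: if_splits)
  then show ?thesis
    using pivot_ok_reduced[OF assms(1,2)] by simp
qed

lemma pivot_reduced_index:
  assumes "F \<subseteq> {..<q}" "reduced_cell j t F u" "threshold j f < (u + set_exp (F - frozen j t)) f"
  shows "f < q" "\<And>i. i < k \<Longrightarrow> f \<noteq> p i" "f \<notin> frozen j t"
proof -
  have pf: "p_free (u + set_exp (F - frozen j t))"
    using p_free_unfrozen[OF assms(1,2)] .
  have nz: "(u + set_exp (F - frozen j t)) f \<noteq> 0"
    using gr_implies_not0[OF assms(3)] .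
  show fq: "f < q"
    using p_freeD(2)[OF pf, of f] nz by linarith
  show fp: "f \<noteq> p i" if "i < k" for i
    using p_freeD(1)[OF pf that] nz by auto
  show "f \<notin> frozen j t"
  proof
    assume fr: "f \<in> frozen j t"
    then have uf: "threshold j f < u f"
      using assms(3) by (simp add: set_exp_def)
    have t: "t = 1 \<or> t = 2"
      using assms(2) by (auto simp: reduced_cell_def)
    have "2 * N \<le> f"
      using fr t by (auto simp: frozen_def)
    then obtain i where i: "i < k" "f = s i"
      using s_index[OF _ fq fp] by blast
    consider "t = 1" "j = k" | "t = 1" "j < k" | "t = 2"
      using assms(2) by (auto simp: reduced_cell_def)
    then show False
    proof cases
      case 1
      then show False
        using assms(2) i uf by (auto simp: reduced_cell_def)
    next
      case 2
      then have u: "0 < u (s j)" "(\<Sum>i<k. u (s i)) < 2"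
        using assms(2) by (auto simp: reduced_cell_def)
      have "u (s i) + (if i = j then 0 else u (s j)) \<le> (\<Sum>i<k. u (s i))"
        using sum_mono2[of "{..<k}" "{i, j}" "\<lambda>i. u (s i)"] i 2 by auto
      then show False
        using u uf i by (auto simp: threshold_def unit_exp_def split: if_splits)
    next
      case 3
      then show False
        using assms(2) i uf fr by (auto simp: reduced_cell_def frozen_def)
    qed
  qed
qed

lemma reduced_cell_face:
  assumes "F \<subseteq> {..<q}" "reduced_cell j t F u" "threshold j f < (u + set_exp (F - frozen j t)) f"
  shows "reduced_cell j t (F - {f}) (u + unit_exp f)"
proof -
  note f = pivot_reduced_index[OF assms]
  have pf: "p_free (u + unit_exp f)"
    using assms(2) f(1,2) p_freeD by (intro p_freeI) (force simp: reduced_cell_def unit_exp_def)+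
  have "f \<noteq> s i" if "i < j" for i
    using f(3) that assms(2) by (auto simp: reduced_cell_def frozen_def dest: s_lt split: if_splits)
  then have low: "(u + unit_exp f) (s i) = 0" if "i < j" for i
    using that assms(2) by (force simp: reduced_cell_def unit_exp_def)
  have sum: "(\<Sum>i<k. (u + unit_exp f) (s i)) = (\<Sum>i<k. u (s i))" if "t = 1"
    using f(3) that by (intro sum.cong) (auto simp: frozen_def unit_exp_def dest: s_lt)
  have "(\<forall>b\<in>B. 0 < u b) \<longleftrightarrow> (\<forall>b\<in>B. 0 < (u + unit_exp f) b)"
  proof (intro iffI)
    show "\<forall>b\<in>B. 0 < u b" if "\<forall>b\<in>B. 0 < (u + unit_exp f) b"
    proof
      fix b assume b: "b \<in> B"
      show "0 < u b"
      proof (cases "b = f")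
        case True
        \<comment> \<open>The set \<open>F\<close> contributes at most 1 to the exponent at
          \<open>b\<close>, and the threshold there is 1, so \<open>b\<close> already occurs in
          \<open>u\<close>.\<close>
        then show ?thesis
          using assms(3) b by (auto simp: threshold_def set_exp_def split: if_splits)
      next
        case False
        then show ?thesis
          using that b by (auto simp: unit_exp_def)
      qed
    qed
  qed auto
  then have B: "(\<forall>b\<in>B. 0 < (u + unit_exp f) b) \<longleftrightarrow> (\<forall>b\<in>B. 0 < u b)"
    by simp
  have "p_free u" "j \<le> k" and "\<forall>i. i \<le> j \<and> i < k \<longrightarrow> p i \<notin> F - {f}" and
    "t = 1 \<and> j = k \<or> j < k \<and> 0 < u (s j) \<and>
      (t = 1 \<and> (\<forall>b\<in>B. 0 < u b) \<and> (\<Sum>i<k. u (s i)) < 2 \<or> t = 2 \<and> \<not> (\<forall>b\<in>B. 0 < u b))"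
    using assms(2) unfolding reduced_cell_def by blast+
  moreover from this have "t = 1 \<and> j = k \<or> j < k \<and> 0 < (u + unit_exp f) (s j) \<and>
      (t = 1 \<and> (\<forall>b\<in>B. 0 < (u + unit_exp f) b) \<and> (\<Sum>i<k. (u + unit_exp f) (s i)) < 2 \<or>
       t = 2 \<and> \<not> (\<forall>b\<in>B. 0 < (u + unit_exp f) b))"
    unfolding B using sum by (elim disjE conjE) simp_all
  ultimately show ?thesis
    unfolding reduced_cell_def using pf low by blast
qed

lemma reduced_cell_insert:
  assumes "F \<subseteq> {..<q}" "reduced_cell j t F u" "threshold j f < (u + set_exp (F - frozen j t)) f" "f \<notin> F"
  shows "reduced_cell j t (insert f F) (u - unit_exp f)" "0 < u f"
proof -
  note f = pivot_reduced_index[OF assms(1-3)]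
  have uf: "threshold j f < u f"
    using assms(3,4) by (simp add: set_exp_def)
  then show "0 < u f"
    by simp
  have pos: "0 < (u - unit_exp f) b" if "0 < u b" "b \<in> B" for b
    using uf that by (auto simp: threshold_def set_exp_def unit_exp_def)
  then have B: "(\<forall>b\<in>B. 0 < (u - unit_exp f) b) \<longleftrightarrow> (\<forall>b\<in>B. 0 < u b)"
    by (auto intro: gr0I)
  have "0 < (u - unit_exp f) (s j)" if "0 < u (s j)"
    using uf that by (auto simp: threshold_def unit_exp_def)
  moreover have "(\<Sum>i<k. (u - unit_exp f) (s i)) \<le> (\<Sum>i<k. u (s i))"
    by (intro sum_mono) simp
  moreover have "t = 1 \<and> j = k \<or> j < k \<and> 0 < u (s j) \<and>
      (t = 1 \<and> (\<forall>b\<in>B. 0 < u b) \<and> (\<Sum>i<k. u (s i)) < 2 \<or> t = 2 \<and> \<not> (\<forall>b\<in>B. 0 < u b))"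
    using assms(2) unfolding reduced_cell_def by blast
  ultimately have "t = 1 \<and> j = k \<or> j < k \<and> 0 < (u - unit_exp f) (s j) \<and>
      (t = 1 \<and> (\<forall>b\<in>B. 0 < (u - unit_exp f) b) \<and> (\<Sum>i<k. (u - unit_exp f) (s i)) < 2 \<or>
       t = 2 \<and> \<not> (\<forall>b\<in>B. 0 < (u - unit_exp f) b))"
    unfolding B by linarith
  moreover have "p_free (u - unit_exp f)" "\<forall>i<j. (u - unit_exp f) (s i) = 0" "j \<le> k"
    using assms(2) by (auto simp: reduced_cell_def p_free_def)
  moreover have "\<forall>i. i \<le> j \<and> i < k \<longrightarrow> p i \<notin> insert f F"
    using assms(2) f(2) unfolding reduced_cell_def by blast
  ultimately show "reduced_cell j t (insert f F) (u - unit_exp f)"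
    unfolding reduced_cell_def by blast
qed

section \<open>Faces and partners of cells\<close>

lemma cell_class_face:
  assumes "(F, m) \<in> koszul_basis q ed i d" "g \<in> F"
  shows "cell_class (F - {g}, m + e g) = cell_class (F, m) \<or>
    class_rank (cell_class (F - {g}, m + e g)) < class_rank (cell_class (F, m))"
proof -
  note F = koszul_basisD[OF assms(1)]
  have gq: "g < q"
    using F(1) assms(2) by auto
  define F' m' where "F' = F - {g}" and "m' = m + e g"
  have F': "F' \<subseteq> {..<q}" "m' \<in> range val"
    using F gq by (auto simp: F'_def m'_def simp flip: edge_val_unit[OF gq] edge_val_add)
  have sum: "m' + val (set_exp F') = m + val (set_exp F)"
    unfolding F'_def m'_def by (rule val_set_exp_face[OF assms(2) gq])
  have le: "stage F' m' \<le> stage F m"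
    unfolding F'_def m'_def by (rule stage_face[OF assms(2) gq F(3)])
  show ?thesis
    unfolding F'_def[symmetric] m'_def[symmetric]
  proof (cases "stage F' m' < stage F m")
    case True
    then show "cell_class (F', m') = cell_class (F, m) \<or> class_rank (cell_class (F', m')) < class_rank (cell_class (F, m))"
      using kind_le[of F' m'] by (auto simp: cell_class_def class_rank_def)
  next
    case False
    then have eq: "stage F' m' = stage F m"
      using le by simp
    define j where "j = stage F m"
    consider "kind F' m' < kind F m" | "kind F m = 0" | "kind F m \<noteq> 0" "kind F m \<le> kind F' m'"
      by linarith
    then show "cell_class (F', m') = cell_class (F, m) \<or> class_rank (cell_class (F', m')) < class_rank (cell_class (F, m))"
    proof cases
      case 1
      then show ?thesis
        using eq by (auto simp: cell_class_def class_rank_def)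
    next
      case 2
      note k0 = kind_0D[OF 2]
      have "p j \<in> F' \<or> divides_by_p j m'"
        using k0 divides_by_p_add[OF _ gq] divides_by_p_add_p[OF F(3) k0(1)]
        by (auto simp: F'_def m'_def j_def)
      then have "kind F' m' = 0"
        using k0(1) by (intro kind_0I) (auto simp: eq j_def)
      then show ?thesis
        using 2 eq sum by (auto simp: cell_class_def frozen_def)
    next
      case 3
      obtain u where u: "m = val u" "reduced_cell j (kind F m) F u"
        using reduced_cellE[OF 3(1) F(3)] unfolding j_def .
      have "kind F' m' \<noteq> 0"
        using 3 by simp
      then obtain u' where u': "m' = val u'" "reduced_cell j (kind F' m') F' u'"
        using reduced_cellE[OF _ F'(2), of F'] unfolding eq j_def by blast
      have m': "m' = val (u + unit_exp g)"
        by (simp add: m'_def u(1) edge_val_add edge_val_unit gq)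
      \<comment> \<open>A transferred \<open>p_l\<close> would lower the rank: before stage
        \<open>k\<close> it is exchanged with \<open>s_j\<close> and gives kind 0, and at stage
        \<open>k\<close> it makes \<open>z_l\<close> used.\<close>
      have gp: "g \<noteq> p l" if "l < k" for l
      proof
        assume g: "g = p l"
        show False
        proof (cases "j < k")
          case True
          then have "0 < u (s j)"
            using u(2) by (auto simp: reduced_cell_def)
          then have "divides_by_p j m'"
            unfolding m' using True that by (intro divides_by_pI1[of _ l]) (auto simp: g unit_exp_def)
          then have "kind F' m' = 0"
            using True by (intro kind_0I) (auto simp: eq j_def)
          then show False
            using \<open>kind F' m' \<noteq> 0\<close> by simp
        next
          case False
          then have "l < stage F' m'"
            using that by (simp add: eq j_def)
          moreover have "meets l m'"
            using that by (simp add: m' g meets_val unit_exp_def)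
          ultimately show False
            using stage_least by blast
        qed
      qed
      have "p_free (u + unit_exp g)"
        using u(2) gq gp p_freeD by (intro p_freeI) (force simp: reduced_cell_def unit_exp_def)+
      then have "u' = u + unit_exp g"
        using val_inj_p_free u' m' by (auto simp: reduced_cell_def)
      note u' = u'[unfolded this]
      \<comment> \<open>Multiplication by \<open>g\<close> preserves divisibility by
        \<open>B\<close>, so the kind cannot rise from 1 to 2, and a fall is excluded in this
        case.\<close>
      have keq: "kind F' m' = kind F m"
        using u(2) u'(2) 3(2) by (auto simp: reduced_cell_def)
      \<comment> \<open>A frozen \<open>s_i\<close> contradicts the normal form of the face: stage
        \<open>k\<close> admits no \<open>s_i\<close>, kind 1 before it only a single one in total,
        and kind 2 none below \<open>j\<close>.\<close>
      have "g \<notin> frozen j (kind F m)"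
      proof
        assume fr: "g \<in> frozen j (kind F m)"
        have "2 * N \<le> g"
          using fr by (auto simp: frozen_def split: if_splits)
        then obtain i where i: "i < k" "g = s i"
          using s_index[OF _ gq gp] by blast
        consider "kind F m = 1" "j = k" | "kind F m = 1" "j < k" | "kind F m = 2"
          using u(2) by (auto simp: reduced_cell_def)
        then show False
        proof cases
          case 1
          then show False
            using u'(2) i by (auto simp: reduced_cell_def unit_exp_def)
        next
          case 2
          then have "0 < u (s j)" "(\<Sum>i<k. (u + unit_exp g) (s i)) < 2"
            using u(2) u'(2) by (auto simp: reduced_cell_def keq)
          moreover have "(\<Sum>i<k. (u + unit_exp g) (s i)) = (\<Sum>i<k. u (s i)) + 1"
            using i by (simp add: sum.distrib unit_exp_def)
          moreover have "u (s j) \<le> (\<Sum>i<k. u (s i))"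
            using 2 by (intro member_le_sum) auto
          ultimately show False
            by simp
        next
          case 3
          then show False
            using u'(2) i fr by (auto simp: reduced_cell_def unit_exp_def frozen_def)
        qed
      qed
      then have "F' \<inter> frozen j (kind F m) = F \<inter> frozen j (kind F m)"
        by (auto simp: F'_def)
      then show ?thesis
        using eq keq sum by (simp add: cell_class_def j_def)
    qed
  qed
qed

lemma cell_class_pivot_down:
  assumes "(F, m) \<in> koszul_basis q ed i d" "pivot (cell_class (F, m)) = Some f" "f \<in> F"
  shows "cell_class (F - {f}, m + e f) = cell_class (F, m)"
proof -
  note F = koszul_basisD[OF assms(1)]
  have fq: "f < q"
    using F(1) assms(3) by auto
  show ?thesis
  proof (cases "kind F m = 0")
    case True
    note k0 = kind_0D[OF True]
    let ?j = "stage F m"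
    have f: "f = p ?j"
      using assms(2) True by (simp add: pivot_def cell_class_def)
    have d: "divides_by_p ?j (m + e f)"
      unfolding f by (rule divides_by_p_add_p[OF F(3) k0(1)])
    have "stage (F - {f}) (m + e f) = ?j"
    proof (rule stage_eqI)
      fix i assume i: "i < ?j"
      then have "i < k"
        using k0(1) by simp
      then show "p i \<notin> F - {f} \<and> \<not> meets i (m + e f)"
        using stage_least[OF i] i meets_add_edge[OF _ fq F(3), of i] k0(1) f by auto
    qed (simp_all add: stage_le divides_by_p_imp_meets[OF d])
    moreover from this have "kind (F - {f}) (m + e f) = 0"
      using k0(1) d by (intro kind_0I) auto
    ultimately show ?thesis
      using True val_set_exp_face[OF assms(3) fq] by (simp add: cell_class_def frozen_def)
  next
    case False
    let ?j = "stage F m" and ?t = "kind F m"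
    obtain u where u: "m = val u" "reduced_cell ?j ?t F u"
      using False F(3) by (rule reduced_cellE)
    have th: "threshold ?j f < (u + set_exp (F - frozen ?j ?t)) f"
      using pivot_reduced[OF F(1) u(2)] assms(2) u(1) by simp
    have r: "reduced_cell ?j ?t (F - {f}) (u + unit_exp f)"
      by (rule reduced_cell_face[OF F(1) u(2) th])
    have m: "m + e f = val (u + unit_exp f)"
      by (simp add: u(1) edge_val_add edge_val_unit fq)
    have fr: "(F - {f}) \<inter> frozen ?j ?t = F \<inter> frozen ?j ?t"
      using pivot_reduced_index(3)[OF F(1) u(2) th] by auto
    have "cell_class (F - {f}, m + e f) = (?j, ?t, F \<inter> frozen ?j ?t, m + e f + val (set_exp (F - {f})))"
      unfolding m cell_class_reduced[OF r] fr ..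
    then show ?thesis
      unfolding val_set_exp_face[OF assms(3) fq] by (simp add: cell_class_def fr)
  qed
qed

lemma cell_class_pivot_up:
  assumes "(F, m) \<in> koszul_basis q ed i d" "pivot (cell_class (F, m)) = Some f" "f \<notin> F"
  shows "\<exists>m'. (insert f F, m') \<in> koszul_basis q ed (i + 1) d \<and> m = m' + e f \<and>
    cell_class (insert f F, m') = cell_class (F, m)"
proof -
  note F = koszul_basisD[OF assms(1)]
  show ?thesis
  proof (cases "kind F m = 0")
    case True
    note k0 = kind_0D[OF True]
    let ?j = "stage F m"
    have f: "f = p ?j"
      using assms(2) True by (simp add: pivot_def cell_class_def)
    have fq: "f < q"
      using k0(1) by (simp add: f q_eq)
    obtain c where c: "m = val c" "0 < c f"
      using k0(2) assms(3) f by (auto simp: divides_by_p_def)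
    define m' where "m' = val (c - unit_exp f)"
    have b: "(insert f F, m') \<in> koszul_basis q ed (i + 1) d" and m: "m = m' + e f"
      using koszul_basis_insert[of F c i d f] assms(1,3) fq c(2) by (simp_all add: c(1) m'_def)
    have "stage (insert f F) m' = ?j"
    proof (rule stage_eqI)
      fix i assume i: "i < ?j"
      then have ik: "i < k"
        using k0(1) by simp
      have "meets i m' \<Longrightarrow> meets i m"
        using meets_add_edge[OF ik fq, of m'] unfolding m by (simp add: m'_def)
      moreover have "p i \<noteq> f"
        using i unfolding f by simp
      ultimately show "p i \<notin> insert f F \<and> \<not> meets i m'"
        using stage_least[OF i] by blast
    qed (simp_all only: stage_le f insert_iff simp_thms)
    moreover from this have "kind (insert f F) m' = 0"
      using k0(1) f by (intro kind_0I) auto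
    moreover have "m' + val (set_exp (insert f F)) = m + val (set_exp F)"
      using val_set_exp_face[of f "insert f F" m'] fq assms(3) by (simp add: m)
    ultimately show ?thesis
      using True b m by (intro exI[of _ m']) (simp add: cell_class_def frozen_def)
  next
    case False
    let ?j = "stage F m" and ?t = "kind F m"
    obtain u where u: "m = val u" "reduced_cell ?j ?t F u"
      using False F(3) by (rule reduced_cellE)
    have th: "threshold ?j f < (u + set_exp (F - frozen ?j ?t)) f"
      using pivot_reduced[OF F(1) u(2)] assms(2) u(1) by simp
    note f = pivot_reduced_index[OF F(1) u(2) th]
    note r = reduced_cell_insert[OF F(1) u(2) th assms(3)]
    define m' where "m' = val (u - unit_exp f)"
    have b: "(insert f F, m') \<in> koszul_basis q ed (i + 1) d" and m: "m = m' + e f"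
      using koszul_basis_insert[of F u i d f] assms(1,3) f(1) r(2) by (simp_all add: u(1) m'_def)
    have fr: "insert f F \<inter> frozen ?j ?t = F \<inter> frozen ?j ?t"
      using f(3) by auto
    have "m' + val (set_exp (insert f F)) = m + val (set_exp F)"
      using val_set_exp_face[of f "insert f F" m'] f(1) assms(3) by (simp add: m)
    then have "cell_class (insert f F, m') = (?j, ?t, F \<inter> frozen ?j ?t, m + val (set_exp F))"
      using cell_class_reduced[OF r(1)] unfolding fr m'_def by simp
    also have "\<dots> = cell_class (F, m)"
      by (simp add: cell_class_def)
    finally show ?thesis
      using b m by blast
  qed
qed

text \<open>Without a pivot, \<open>u\<close> divides \<open>B s_j\<close> and has degree at most
  \<open>N + 1\<close>. This is the origin of the value of the regularity.\<close>

lemma pivot_exists: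
  assumes "(F, m) \<in> koszul_basis q ed i d" "i + N + 2 \<le> d"
  shows "pivot (cell_class (F, m)) \<noteq> None"
proof (cases "kind F m = 0")
  case True
  then show ?thesis
    by (simp add: pivot_def cell_class_def)
next
  case False
  note F = koszul_basisD[OF assms(1)]
  let ?j = "stage F m" and ?t = "kind F m"
  obtain u where u: "m = val u" "reduced_cell ?j ?t F u"
    using False F(3) by (rule reduced_cellE)
  let ?\<tau> = "u + set_exp (F - frozen ?j ?t)"
  have "\<exists>v. threshold ?j v < ?\<tau> v"
  proof (rule ccontr)
    assume "\<not> ?thesis"
    then have "u v \<le> threshold ?j v" for v
      by (metis add_leE linorder_not_less plus_fun_apply)
    then have "sum u {..<q} \<le> sum (threshold ?j) {..<q}"
      by (intro sum_mono) auto
    also have "\<dots> = sum (set_exp B) {..<q} + sum (unit_exp (s ?j)) {..<q}"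
      by (simp add: threshold_def sum.distrib)
    also have "sum (set_exp B) {..<q} = card ({..<q} \<inter> B)"
      unfolding set_exp_def by (simp add: sum.If_cases)
    also have "\<dots> \<le> card B"
      by (intro card_mono) auto
    \<comment> \<open>Only an inequality, since at stage \<open>k\<close> the index
      \<open>s k\<close> equals \<open>q\<close> and lies outside the range.\<close>
    also have "sum (unit_exp (s ?j)) {..<q} \<le> 1"
      by (simp add: unit_exp_def)
    finally have "sum u {..<q} \<le> N + 1"
      using AB(4) by simp
    moreover have "sum u {..<q} = d - i"
      using assms(1) by (intro val_in_edge_monos) (auto simp: koszul_basis_def u(1))
    ultimately show False
      using assms(2) by simp
  qed
  then have "\<exists>v. pivot_ok ?j (F \<inter> frozen ?j ?t) (m + val (set_exp F)) v"
    using pivot_ok_reduced[OF F(1) u(2)] u(1) by simp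
  then show ?thesis
    by (simp add: pivot_def cell_class_def)
qed

lemma betti_eq_0:
  assumes "i + N + 2 \<le> d"
  shows "betti TYPE('a :: field) q ed i d = 0"
proof (rule betti_eq_0_if_matching[where \<kappa> = cell_class and \<rho> = class_rank and \<phi> = pivot])
  show "pivot (cell_class (F, m)) \<noteq> None" if "(F, m) \<in> koszul_basis q ed i d" for F m
    using that assms by (rule pivot_exists)
qed (rule cell_class_face cell_class_pivot_up cell_class_pivot_down; assumption)+

subsection \<open>The minimal generator of degree N + 2\<close>

text \<open>For \<open>k > 0\<close>, the equations \<open>c (s 0) = 2 * n\<close> and
  \<open>c (p 0) + c (s 0) = 2\<close> leave only \<open>n = 0\<close> and \<open>n = 1\<close>,
  that is, the monomials \<open>p_0^2 A\<close> and \<open>s_0^2 B\<close>. They share no edge, so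
  their binomial is not generated in lower degrees.\<close>

lemma generator_fibre:
  assumes "val c = val (unit_exp (p 0) + unit_exp (p 0) + set_exp A)" "f < q" "g < q" "0 < c f" "0 < c g"
  shows "f \<in> insert (p 0) A \<longleftrightarrow> g \<in> insert (p 0) A"
proof -
  have out: "s l \<notin> A" "p l \<notin> A" "s l \<notin> B" "p l \<notin> B" for l
    using AB_lt by force+
  obtain n :: int where n: "\<And>j. j < k \<Longrightarrow> c (p j) + c (s j) = (if j = 0 then 2 else 0)"
    "(\<Sum>j<k. int (c (s j))) = 2 * n"
    "\<And>b. b \<in> B \<Longrightarrow> int (c b) = n" "\<And>a. a \<in> A \<Longrightarrow> int (c a) = 1 - n"
  proof -
    obtain n :: int where n: "\<And>j. j < k \<Longrightarrow> (unit_exp (p 0) + unit_exp (p 0) + set_exp A) (p j)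
         + (unit_exp (p 0) + unit_exp (p 0) + set_exp A) (s j) = c (p j) + c (s j)"
      "(\<Sum>j<k. int (c (s j))) = (\<Sum>j<k. int ((unit_exp (p 0) + unit_exp (p 0) + set_exp A) (s j))) + 2 * n"
      "\<And>b. b \<in> B \<Longrightarrow> int (c b) = int ((unit_exp (p 0) + unit_exp (p 0) + set_exp A) b) + n"
      "\<And>a. a \<in> A \<Longrightarrow> int (c a) = int ((unit_exp (p 0) + unit_exp (p 0) + set_exp A) a) - n"
      using val_eqE[OF assms(1)[symmetric]] by blast
    show ?thesis
    proof (rule that[of n])
      fix j assume "j < k"
      then show "c (p j) + c (s j) = (if j = 0 then 2 else 0)"
        using n(1)[of j] out by (auto simp: unit_exp_def set_exp_def)
    next
      have "(\<Sum>j<k. int ((unit_exp (p 0) + unit_exp (p 0) + set_exp A) (s j))) = 0"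
        using out by (intro sum.neutral) (auto simp: unit_exp_def set_exp_def)
      then show "(\<Sum>j<k. int (c (s j))) = 2 * n"
        using n(2) by simp
    next
      fix b assume b: "b \<in> B"
      then have "b \<notin> A" "b \<noteq> 2 * N"
        using AB(2) AB_lt(2)[OF b] by auto
      then show "int (c b) = n"
        using n(3)[OF b] by (simp add: unit_exp_def set_exp_def)
    next
      fix a assume a: "a \<in> A"
      then have "a \<noteq> 2 * N"
        using AB_lt(1)[OF a] by auto
      then show "int (c a) = 1 - n"
        using n(4)[OF a] a by (simp add: unit_exp_def set_exp_def)
    qed
  qed
  have s0: "int (c (s 0)) = 2 * n" if "0 < k"
  proof -
    have "(\<Sum>j<k. int (c (s j))) = (\<Sum>j\<in>{0}. int (c (s j)))"
    proof (rule sum.mono_neutral_right)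
      show "\<forall>j\<in>{..<k} - {0}. int (c (s j)) = 0"
      proof
        fix j assume "j \<in> {..<k} - {0}"
        then show "int (c (s j)) = 0"
          using n(1)[of j] by simp
      qed
    qed (use that in auto)
    then show ?thesis
      using n(2) by simp
  qed
  have "i \<in> insert (p 0) A \<longleftrightarrow> n \<le> 0" if "i < q" "0 < c i" for i
    using that(1)
  proof (cases rule: index_cases)
    case 1
    then show ?thesis
      using n(4)[of i] that(2) by simp
  next
    case 2
    then show ?thesis
      using n(3)[of i] that(2) AB(2) AB_lt(2)[of i] by auto
  next
    case (3 j)
    then have j: "j = 0"
      using n(1)[of j] that(2) by (auto split: if_splits)
    have "c i + c (s 0) = 2"
      using n(1)[of 0] 3 j by simp
    then show ?thesis
      using s0 3 j that(2) by simp
  next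
    case (4 j)
    then have j: "j = 0"
      using n(1)[of j] that(2) by (auto split: if_splits)
    then show ?thesis
      using s0 4 that(2) out(1)[of 0] by simp
  qed
  then show ?thesis
    using assms(2-5) by blast
qed

lemma betti_generator:
  assumes "0 < k"
  shows "betti TYPE('a :: field) q ed 1 (N + 2) \<noteq> 0"
proof -
  define \<sigma> where "\<sigma> = val (unit_exp (p 0) + unit_exp (p 0) + set_exp A)"
  let ?X = "koszul_basis q ed 1 (N + 2)"
  define m\<^sub>1 m\<^sub>2 where "m\<^sub>1 = val (unit_exp (p 0) + set_exp A)" and "m\<^sub>2 = val (unit_exp (s 0) + set_exp B)"
  have lt: "p 0 < q" "s 0 < q"
    using assms q_eq by auto
  have \<sigma>1: "m\<^sub>1 + e (p 0) = \<sigma>"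
    using lt by (simp add: m\<^sub>1_def \<sigma>_def edge_val_add edge_val_unit add_ac)
  have \<sigma>2: "m\<^sub>2 + e (s 0) = \<sigma>"
    using lt val_swap[OF assms assms] by (simp add: m\<^sub>2_def \<sigma>_def edge_val_add edge_val_unit add_ac)
  have deg: "sum (unit_exp v + set_exp C) {..<q} = Suc (card C)" if "v < q" "C \<subseteq> {..<q}" for v C
  proof -
    have "sum (set_exp C) {..<q} = card C"
      using that(2) unfolding set_exp_def by (simp add: sum.If_cases Int_absorb1)
    then show ?thesis
      using that(1) by (simp add: sum.distrib unit_exp_def)
  qed
  have "A \<subseteq> {..<q}" "B \<subseteq> {..<q}"
    using AB_lt q_ge by force+
  then have x12: "({p 0}, m\<^sub>1) \<in> ?X" "({s 0}, m\<^sub>2) \<in> ?X"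
    using lt val_edge_monosI[of "unit_exp (p 0) + set_exp A"] val_edge_monosI[of "unit_exp (s 0) + set_exp B"]
      deg[of "p 0" A] deg[of "s 0" B] AB(3,4)
    by (auto simp: koszul_basis_def m\<^sub>1_def m\<^sub>2_def)
  \<comment> \<open>The Koszul cycle of \<open>p_0^2 A - s_0^2 B\<close>, with one factor
    \<open>p_0\<close> and one factor \<open>s_0\<close> split off.\<close>
  define z :: "_ \<Rightarrow> 'a" where "z a = (if a = ({p 0}, m\<^sub>1) then 1 else if a = ({s 0}, m\<^sub>2) then - 1 else 0)" for a
  \<comment> \<open>Adds the coefficients of the cells over \<sigma> whose edge lies on the
    \<open>A\<close> side. The two terms of a boundary cancel because their edges occur in a common
    monomial of the fibre.\<close>
  define l :: "_ \<Rightarrow> 'a" where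
    "l = (\<lambda>(F, m). if m + e (the_elem F) = \<sigma> \<and> the_elem F \<in> insert (p 0) A then 1 else 0)"
  have s0: "s 0 \<notin> insert (p 0) A" "p 0 \<noteq> s 0"
    using AB_lt(1)[of "s 0"] assms by auto
  have sum_z: "(\<Sum>a\<in>?X. g a * z a) = g ({p 0}, m\<^sub>1) - g ({s 0}, m\<^sub>2)" for g :: "_ \<Rightarrow> 'a"
  proof -
    have "(\<Sum>a\<in>?X. g a * z a) = (\<Sum>a\<in>{({p 0}, m\<^sub>1), ({s 0}, m\<^sub>2)}. g a * z a)"
      using x12 by (intro sum.mono_neutral_right finite_koszul_basis) (auto simp: z_def)
    then show ?thesis
      using s0(2) by (simp add: z_def)
  qed
  have "mat_rank (koszul_basis q ed 0 (N + 2)) ?X (koszul_coef ed :: _ \<Rightarrow> _ \<Rightarrow> 'a)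
      + mat_rank ?X (koszul_basis q ed 2 (N + 2)) (koszul_coef ed :: _ \<Rightarrow> _ \<Rightarrow> 'a) < card ?X"
  proof (rule rank_sum_less[where l = l and z = z])
    show "finite ?X" "finite (koszul_basis q ed 2 (N + 2))"
      by (rule finite_koszul_basis)+
    have empty: "fst y = {}" if "y \<in> koszul_basis q ed 0 (N + 2)" for y
      using that finite_subset[OF _ finite_lessThan[of q]] by (auto simp: koszul_basis_def)
    show "(\<Sum>x\<in>?X. koszul_coef ed y x * z x) = 0" if y0: "y \<in> koszul_basis q ed 0 (N + 2)" for y
    proof -
      obtain m where y: "y = ({}, m)"
        using empty[OF y0] by (metis fst_conv surj_pair)
      show ?thesis
        unfolding sum_z y koszul_coef_to_empty \<sigma>1 \<sigma>2 by simp
    qed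
    show "(\<Sum>x\<in>?X. koszul_coef ed y x * koszul_coef ed x a) = (0 :: 'a)"
      if y0: "y \<in> koszul_basis q ed 0 (N + 2)" and a: "a \<in> koszul_basis q ed 2 (N + 2)" for y a
    proof -
      obtain m where y: "y = ({}, m)"
        using empty[OF y0] by (metis fst_conv surj_pair)
      obtain u v m' where uv: "a = ({u, v}, m')" "u < v"
        using a by (rule koszul_basis_pairE)
      show ?thesis
        unfolding uv(1) y koszul_coef_pair_sum[OF a[unfolded uv(1)] uv(2)] koszul_coef_to_empty
        by (simp add: add_ac)
    qed
    show "(\<Sum>x\<in>?X. l x * koszul_coef ed x a) = 0" if a: "a \<in> koszul_basis q ed 2 (N + 2)" for a
    proof -
      obtain u v m where uv: "a = ({u, v}, m)" "u < v" "v < q" "m \<in> edge_monos q ed (N + 2 - 2)"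
        using a by (rule koszul_basis_pairE)
      obtain c where c: "m = val c"
        using uv(4) by (auto simp: edge_monos_eq)
      have "m + e u + e v = val (c + unit_exp u + unit_exp v)"
        using uv by (simp add: c edge_val_add edge_val_unit)
      then have "v \<in> insert (p 0) A \<longleftrightarrow> u \<in> insert (p 0) A" if "m + e u + e v = \<sigma>"
        using generator_fibre[of "c + unit_exp u + unit_exp v" v u] uv that by (auto simp: \<sigma>_def unit_exp_def)
      then show ?thesis
        unfolding uv(1) koszul_coef_pair_sum[OF a[unfolded uv(1)] uv(2)]
        by (auto simp: l_def add_ac)
    qed
    show "(\<Sum>x\<in>?X. l x * z x) \<noteq> 0"
      unfolding sum_z using s0 \<sigma>1 by (simp add: l_def)
  qed
  then show ?thesis
    unfolding betti_def diff_self_eq_0 one_add_one by linarith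
qed

subsection \<open>The Hilbert series\<close>

definition tail_vars :: "nat \<Rightarrow> nat set" where
  "tail_vars j = {..<2 * N} \<union> {s j..<q}"

definition non_B_monos :: "nat \<Rightarrow> nat \<Rightarrow> (nat \<Rightarrow> nat) set" where
  "non_B_monos j d = {u \<in> monos_on (tail_vars j) d. \<not> (\<forall>b\<in>B. 0 < u b)}"

text \<open>The monomial basis of the cyclic module generated by \<open>s_j\<close>: multiples of
  \<open>s_j\<close> that avoid all \<open>B s_i s_j\<close>.\<close>

definition std_monos :: "nat \<Rightarrow> nat \<Rightarrow> (nat \<Rightarrow> nat) set" where
  "std_monos j d = {u \<in> monos_on (tail_vars j) d. 0 < u (s j) \<and>
     \<not> ((\<forall>b\<in>B. 0 < u b) \<and> 2 \<le> (\<Sum>i<k. u (s i)))}"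

text \<open>Interpolates between the whole edge ring at \<open>j = 0\<close> and the polynomial ring
  in the cycle edges at \<open>j = k\<close>.\<close>

definition tail_edge_monos :: "nat \<Rightarrow> nat \<Rightarrow> (nat \<Rightarrow> nat) set" where
  "tail_edge_monos j d = {m \<in> edge_monos q ed d. \<forall>i<j. \<not> meets i m}"

lemma finite_tail_vars [simp]: "finite (tail_vars j)"
  by (simp add: tail_vars_def)

lemma tail_vars_sub: "tail_vars j \<subseteq> {..<q}"
  using q_ge by (auto simp: tail_vars_def)

lemma B_sub_tail: "B \<subseteq> tail_vars j"
  using AB_lt by (auto simp: tail_vars_def)

lemma card_tail_vars: "j \<le> k \<Longrightarrow> card (tail_vars j) = 2 * N + (k - j)"
  unfolding tail_vars_def by (subst card_Un_disjoint) (auto simp: q_eq)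

lemma finite_non_B_monos: "finite (non_B_monos j d)"
  by (simp add: non_B_monos_def finite_monos_on)

lemma finite_std_monos: "finite (std_monos j d)"
  by (simp add: std_monos_def finite_monos_on)

lemma finite_tail_edge_monos: "finite (tail_edge_monos j d)"
  by (simp add: tail_edge_monos_def finite_edge_monos)

lemma count_non_B_monos:
  "count_series (non_B_monos j) = (1 - fps_X ^ N) * count_series (monos_on (tail_vars j))"
proof -
  let ?R = "tail_vars j"
  have B: "set_exp B \<in> monos_on ?R N"
    using set_exp_in_monos_on[OF finite_tail_vars B_sub_tail] AB(4) by simp
  have "count_series (monos_on ?R) = fps_X ^ N * count_series (monos_on ?R) + count_series (non_B_monos j)"
  proof (rule count_series_split[where f = "\<lambda>u. u + set_exp B"])
    show "inj_on (\<lambda>u. u + set_exp B) (monos_on ?R d)" for d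
      by (simp add: inj_on_def)
    show "monos_on ?R d = non_B_monos j d" if "d < N" for d
    proof -
      have "\<not> (\<forall>b\<in>B. 0 < u b)" if u: "u \<in> monos_on ?R d" for u
      proof
        assume "\<forall>b\<in>B. 0 < u b"
        then have "(\<Sum>b\<in>B. 1) \<le> sum u B"
          by (intro sum_mono) (simp add: Suc_le_eq)
        also have "sum u B \<le> sum u ?R"
          by (intro sum_mono2 finite_tail_vars B_sub_tail) auto
        finally show False
          using u \<open>d < N\<close> AB(4) by (simp add: monos_on_def)
      qed
      then show ?thesis
        by (auto simp: non_B_monos_def)
    qed
    show "monos_on ?R (d + N) = (\<lambda>u. u + set_exp B) ` monos_on ?R d \<union> non_B_monos j (d + N)" for d
    proof (intro equalityI subsetI)
      fix u assume u: "u \<in> monos_on ?R (d + N)"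
      show "u \<in> (\<lambda>u. u + set_exp B) ` monos_on ?R d \<union> non_B_monos j (d + N)"
      proof (cases "\<forall>b\<in>B. 0 < u b")
        case True
        then have "set_exp B x \<le> u x" for x
          by (auto simp: set_exp_def Suc_le_eq)
        from monos_on_diff[OF u B this] show ?thesis
          by blast
      next
        case False
        then show ?thesis
          using u by (simp add: non_B_monos_def)
      qed
    next
      fix u assume "u \<in> (\<lambda>u. u + set_exp B) ` monos_on ?R d \<union> non_B_monos j (d + N)"
      then show "u \<in> monos_on ?R (d + N)"
        using monos_on_add[OF _ B] by (auto simp: non_B_monos_def)
    qed
    show "(\<lambda>u. u + set_exp B) ` monos_on ?R d \<inter> non_B_monos j (d + N) = {}" for d
      by (auto simp: non_B_monos_def set_exp_def)
  qed (simp_all add: finite_monos_on finite_non_B_monos)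
  then show ?thesis
    by (simp add: algebra_simps)
qed

text \<open>If \<open>B\<close> divides \<open>u\<close>, then \<open>s_j\<close> is the only
  \<open>s_i\<close> in \<open>u\<close> and occurs once, so division by \<open>B s_j\<close> leaves
  a monomial in the cycle edges. Otherwise division by \<open>s_j\<close> leaves any monomial that
  \<open>B\<close> does not divide.\<close>

lemma count_std_monos:
  assumes j: "j < k"
  shows "count_series (std_monos j) =
    fps_X ^ (N + 1) * count_series (monos_on {..<2 * N}) + fps_X * count_series (non_B_monos j)"
proof -
  let ?R = "tail_vars j"
  define L where "L d = {u \<in> monos_on ?R d. 0 < u (s j) \<and> \<not> (\<forall>b\<in>B. 0 < u b)}" for d
  have L_sub: "L d \<subseteq> std_monos j d" for d
    by (auto simp: L_def std_monos_def)
  have finL: "finite (L d)" for d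
    by (simp add: L_def finite_monos_on)
  have sj: "s j \<in> ?R"
    using s_lt[OF j] by (simp add: tail_vars_def)
  have sjB: "s j \<notin> B" "s i \<noteq> s j \<longleftrightarrow> i \<noteq> j" for i
    using AB_lt(2)[of "s j"] by auto
  have un: "unit_exp (s j) \<in> monos_on ?R 1"
    using sj by (intro unit_exp_in_monos_on) auto
  have BS: "set_exp B + unit_exp (s j) \<in> monos_on ?R (N + 1)"
    using monos_on_add[OF set_exp_in_monos_on[OF finite_tail_vars B_sub_tail] un] AB(4) by simp
  have "count_series (std_monos j) = fps_X ^ (N + 1) * count_series (monos_on {..<2 * N}) + count_series L"
  proof (rule count_series_split[where f = "\<lambda>u. u + (set_exp B + unit_exp (s j))"])
    show "inj_on (\<lambda>u. u + (set_exp B + unit_exp (s j))) (monos_on {..<2 * N} d)" for d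
      by (simp add: inj_on_def)
    have pos: "set_exp B x + unit_exp (s j) x \<le> u x" if "0 < u (s j)" "\<forall>b\<in>B. 0 < u b" for u :: "nat \<Rightarrow> nat" and x
      using that sjB by (auto simp: set_exp_def unit_exp_def Suc_le_eq)
    show "std_monos j d = L d" if d: "d < N + 1" for d
    proof -
      have "\<not> (\<forall>b\<in>B. 0 < u b)" if u: "u \<in> std_monos j d" for u
      proof
        assume "\<forall>b\<in>B. 0 < u b"
        then have "sum (set_exp B + unit_exp (s j)) ?R \<le> sum u ?R"
          using u pos by (intro sum_mono) (auto simp: std_monos_def)
        then show False
          using u d BS by (simp add: std_monos_def monos_on_def)
      qed
      then show ?thesis
        using L_sub by (auto simp: L_def std_monos_def)
    qed
    show "std_monos j (d + (N + 1)) =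
        (\<lambda>u. u + (set_exp B + unit_exp (s j))) ` monos_on {..<2 * N} d \<union> L (d + (N + 1))" for d
    proof (intro equalityI subsetI)
      fix u assume u: "u \<in> std_monos j (d + (N + 1))"
      show "u \<in> (\<lambda>u. u + (set_exp B + unit_exp (s j))) ` monos_on {..<2 * N} d \<union> L (d + (N + 1))"
      proof (cases "\<forall>b\<in>B. 0 < u b")
        case True
        have uR: "u \<in> monos_on ?R (d + (N + 1))" and usj: "0 < u (s j)"
          using u by (auto simp: std_monos_def)
        have "(set_exp B + unit_exp (s j)) x \<le> u x" for x
          using pos[OF usj True, of x] by simp
        note v = monos_on_diff[OF uR BS this]
        let ?v = "u - (set_exp B + unit_exp (s j))"
        have "\<not> 2 \<le> (\<Sum>i<k. u (s i))"
          using u True unfolding std_monos_def by blast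
        then have le1: "(\<Sum>i<k. u (s i)) \<le> 1"
          by linarith
        have s0: "?v (s i) = 0" if "i < k" for i
        proof -
          have "u (s i) + (if i = j then 0 else u (s j)) \<le> (\<Sum>i<k. u (s i))"
            using sum_mono2[of "{..<k}" "{i, j}" "\<lambda>i. u (s i)"] that j by auto
          then show ?thesis
            using le1 usj by (auto simp: unit_exp_def split: if_splits)
        qed
        have zero: "?v x = 0" if "x \<notin> {..<2 * N}" for x
        proof (cases "x \<in> ?R")
          case True
          then have x: "2 * N + k + j \<le> x" "x < q"
            using that by (auto simp: tail_vars_def)
          have "\<exists>i<k. x = s i"
            using x q_eq by (intro exI[of _ "x - (2 * N + k)"]) linarith
          then obtain i where i: "i < k" "x = s i"
            by blast
          show ?thesis
            unfolding i(2) by (rule s0[OF i(1)])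
        next
          case False
          then show ?thesis
            using v(1) unfolding monos_on_def by blast
        qed
        have "sum ?v ?R = sum ?v {..<2 * N}"
          using zero by (intro sum.mono_neutral_right finite_tail_vars) (auto simp: tail_vars_def)
        then have "?v \<in> monos_on {..<2 * N} d"
          using v(1) zero unfolding monos_on_def by auto
        then show ?thesis
          using v(2) by blast
      next
        case False
        then show ?thesis
          using u by (auto simp: L_def std_monos_def)
      qed
    next
      fix u assume "u \<in> (\<lambda>u. u + (set_exp B + unit_exp (s j))) ` monos_on {..<2 * N} d \<union> L (d + (N + 1))"
      then consider v where "u = v + (set_exp B + unit_exp (s j))" "v \<in> monos_on {..<2 * N} d" | "u \<in> L (d + (N + 1))"
        by blast
      then show "u \<in> std_monos j (d + (N + 1))"
      proof cases
        case 1
        have "sum v ?R = sum v {..<2 * N}"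
          using 1(2) by (intro sum.mono_neutral_right finite_tail_vars) (auto simp: tail_vars_def monos_on_def)
        then have "v \<in> monos_on ?R d"
          using 1(2) by (auto simp: monos_on_def tail_vars_def)
        then have "u \<in> monos_on ?R (d + (N + 1))"
          using monos_on_add[OF _ BS] 1(1) by blast
        moreover have "u (s i) = (if i = j then 1 else 0)" for i
          using 1 AB_lt(2)[of "s i"] by (auto simp: monos_on_def set_exp_def unit_exp_def)
        ultimately show ?thesis
          using j by (simp add: std_monos_def)
      next
        case 2
        then show ?thesis
          using L_sub by blast
      qed
    qed
    show "(\<lambda>u. u + (set_exp B + unit_exp (s j))) ` monos_on {..<2 * N} d \<inter> L (d + (N + 1)) = {}" for d
      by (auto simp: L_def set_exp_def)
  qed (simp_all add: finite_monos_on finL)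
  \<comment> \<open>Division by \<open>s_j\<close> is a bijection here, so the complement is
    empty.\<close>
  also have "count_series L = fps_X ^ 1 * count_series (non_B_monos j) + count_series (\<lambda>_. {} :: (nat \<Rightarrow> nat) set)"
  proof (rule count_series_split[where f = "\<lambda>u. u + unit_exp (s j)"])
    show "inj_on (\<lambda>u. u + unit_exp (s j)) (non_B_monos j d)" for d
      by (simp add: inj_on_def)
    show "L d = {}" if "d < 1" for d
      using that sj by (auto simp: L_def monos_on_def)
    have eqB: "(\<forall>b\<in>B. 0 < (u + unit_exp (s j)) b) \<longleftrightarrow> (\<forall>b\<in>B. 0 < u b)" for u
      using sjB by (auto simp: unit_exp_def split: if_splits)
    show "L (d + 1) = (\<lambda>u. u + unit_exp (s j)) ` non_B_monos j d \<union> {}" for d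
    proof (intro equalityI subsetI)
      fix u assume u: "u \<in> L (d + 1)"
      then have "u \<in> monos_on ?R (d + 1)" "unit_exp (s j) x \<le> u x" for x
        by (auto simp: L_def unit_exp_def)
      note v = monos_on_diff[OF this(1) un this(2)]
      have "\<not> (\<forall>b\<in>B. 0 < u b)"
        using u by (simp add: L_def)
      then have "\<not> (\<forall>b\<in>B. 0 < (u - unit_exp (s j)) b)"
        using eqB[of "u - unit_exp (s j)"] unfolding v(2)[symmetric] by blast
      then have "u - unit_exp (s j) \<in> non_B_monos j d"
        using v(1) unfolding non_B_monos_def by blast
      then show "u \<in> (\<lambda>u. u + unit_exp (s j)) ` non_B_monos j d \<union> {}"
        using v(2) by blast
    next
      fix u assume "u \<in> (\<lambda>u. u + unit_exp (s j)) ` non_B_monos j d \<union> {}"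
      then obtain v where v: "u = v + unit_exp (s j)" "v \<in> non_B_monos j d"
        by blast
      then have "\<not> (\<forall>b\<in>B. 0 < u b)"
        using eqB[of v] by (simp add: non_B_monos_def)
      moreover have "u \<in> monos_on ?R (d + 1)"
        using v monos_on_add[OF _ un, of v d] by (simp add: non_B_monos_def)
      ultimately show "u \<in> L (d + 1)"
        using v(1) by (simp add: L_def unit_exp_def)
    qed
  qed (simp_all add: finite_non_B_monos)
  also have "count_series (\<lambda>_. {} :: (nat \<Rightarrow> nat) set) = 0"
    by (simp add: count_series_def fps_eq_iff)
  finally show ?thesis
    by simp
qed

lemma std_monos_p_free:
  assumes "u \<in> std_monos j d" "j < k"
  shows "p_free u" "sum u {..<q} = d"
proof -
  have z: "u x = 0" if "x \<notin> tail_vars j" for x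
    using assms that by (auto simp: std_monos_def monos_on_def)
  show "p_free u"
    by (rule p_freeI; rule z) (use q_ge in \<open>auto simp: tail_vars_def\<close>)
  have "sum u {..<q} = sum u (tail_vars j)"
    by (rule sum.mono_neutral_right) (use z tail_vars_sub in auto)
  then show "sum u {..<q} = d"
    using assms by (simp add: std_monos_def monos_on_def)
qed

lemma std_monos_not_divides:
  assumes "u \<in> std_monos j d" "j < k"
  shows "\<not> divides_by_p j (val u)"
proof
  assume "divides_by_p j (val u)"
  note p_free_divides[OF std_monos_p_free(1)[OF assms] assms(2) this]
  then show False
    using assms(1) unfolding std_monos_def by blast
qed

text \<open>The normal form of the matching for \<open>F = {}\<close>, where, at a stage below
  \<open>k\<close>, kind 0 means divisibility by \<open>p_j\<close>.\<close>

lemma tail_edge_monos_cases: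
  assumes "m \<in> tail_edge_monos j d" "j < k" "meets j m" "\<not> divides_by_p j m"
  shows "m \<in> val ` std_monos j d"
proof -
  have m: "m \<in> edge_monos q ed d" and below: "\<And>i. i < j \<Longrightarrow> \<not> meets i m"
    using assms(1) by (auto simp: tail_edge_monos_def)
  have st: "stage {} m = j"
    using assms(2,3) below by (intro stage_eqI) auto
  have "kind {} m \<noteq> 0"
    using kind_0D(2)[of "{}" m] assms(4) by (auto simp: st)
  moreover have "m \<in> range val"
    using m by (auto simp: edge_monos_eq)
  ultimately obtain u where u: "m = val u" "reduced_cell j (kind {} m) {} u"
    using reduced_cellE[of "{}" m] unfolding st by blast
  have pf: "p_free u" and low: "\<forall>i<j. u (s i) = 0"
    using u(2) unfolding reduced_cell_def by blast+
  have z: "u x = 0" if "x \<notin> tail_vars j" for x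
  proof (cases "x < q")
    case True
    then show ?thesis
    proof (cases rule: index_cases)
      case (3 i)
      then show ?thesis using p_freeD(1)[OF pf] by simp
    next
      case (4 i)
      then show ?thesis using low that True by (auto simp: tail_vars_def)
    qed (use that AB_lt in \<open>auto simp: tail_vars_def\<close>)
  qed (use p_freeD(2)[OF pf] in auto)
  have "sum u {..<q} = sum u (tail_vars j)"
    by (rule sum.mono_neutral_right) (use z tail_vars_sub in auto)
  then have "u \<in> monos_on (tail_vars j) d"
    using val_in_edge_monos[of u d] m z by (auto simp: monos_on_def u(1))
  moreover have "0 < u (s j)" "\<not> ((\<forall>b\<in>B. 0 < u b) \<and> 2 \<le> (\<Sum>i<k. u (s i)))"
    using u(2) assms(2) by (auto simp: reduced_cell_def)
  ultimately show ?thesis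
    unfolding u(1) std_monos_def by blast
qed

text \<open>Multiplication by \<open>p_j\<close> is injective. The monomials outside its image
  either meet \<open>z_j\<close> and are standard, or avoid \<open>z_j\<close> and belong to the
  next stage.\<close>

lemma count_tail_edge_monos_step:
  assumes j: "j < k"
  shows "count_series (tail_edge_monos j) = fps_X * count_series (tail_edge_monos j)
    + (count_series (std_monos j) + count_series (tail_edge_monos (Suc j)))"
proof -
  define L where "L d = val ` std_monos j d \<union> tail_edge_monos (Suc j) d" for d
  have pj: "p j < q"
    using j by (simp add: q_eq)
  have std_meets: "meets j (val u)" if "u \<in> std_monos j d" for u d
    using that j by (simp add: meets_val std_monos_def)
  have suc: "m \<in> tail_edge_monos (Suc j) d \<longleftrightarrow> m \<in> tail_edge_monos j d \<and> \<not> meets j m" for m d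
    by (auto simp: tail_edge_monos_def less_Suc_eq)
  have std_sub: "val u \<in> tail_edge_monos j d" if "u \<in> std_monos j d" for u d
  proof -
    have "val u \<in> edge_monos q ed d"
      using val_edge_monosI[of u] std_monos_p_free(2)[OF that j] by simp
    moreover have "\<not> meets i (val u)" if "i < j" for i
    proof -
      have "u (p i) = 0" "u (s i) = 0"
        using \<open>u \<in> std_monos j d\<close> that j by (auto simp: std_monos_def monos_on_def tail_vars_def)
      then show ?thesis
        using that j by (simp add: meets_val)
    qed
    ultimately show ?thesis
      by (simp add: tail_edge_monos_def)
  qed
  have "count_series (tail_edge_monos j) = fps_X ^ 1 * count_series (tail_edge_monos j) + count_series L"
  proof (rule count_series_split[where f = "\<lambda>m. m + e (p j)"])
    show "inj_on (\<lambda>m. m + e (p j)) (tail_edge_monos j d)" for d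
      by (simp add: inj_on_def)
    have div: "\<exists>d'. d = Suc d' \<and> m \<in> (\<lambda>m. m + e (p j)) ` tail_edge_monos j d'"
      if m: "m \<in> tail_edge_monos j d" "divides_by_p j m" for m d
    proof -
      obtain c where c: "m = val c" "0 < c (p j)"
        using m(2) by (auto simp: divides_by_p_def)
      define c0 where "c0 = c - unit_exp (p j)"
      have cc: "c = c0 + unit_exp (p j)"
        unfolding c0_def using c(2) by (rule unit_exp_remove)
      have "m = val c0 + e (p j)"
        unfolding c(1) cc by (simp add: edge_val_add edge_val_unit pj)
      moreover have "d = Suc (sum c0 {..<q})"
      proof -
        have "d = sum c {..<q}"
          using val_in_edge_monos[of c d] m(1) by (simp add: tail_edge_monos_def c(1))
        also have "\<dots> = sum c0 {..<q} + sum (unit_exp (p j)) {..<q}"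
          unfolding cc by (simp add: sum.distrib)
        also have "sum (unit_exp (p j)) {..<q} = 1"
          using pj by (simp add: unit_exp_def)
        finally show ?thesis
          by simp
      qed
      moreover have "val c0 \<in> tail_edge_monos j (sum c0 {..<q})"
      proof -
        have "\<not> meets i (val c0)" if "i < j" for i
        proof -
          have "\<not> meets i (val c)"
            using m(1) that by (auto simp: tail_edge_monos_def c(1))
          then show ?thesis
            using that j by (simp add: meets_val c0_def)
        qed
        then show ?thesis
          using val_edge_monosI by (simp add: tail_edge_monos_def)
      qed
      ultimately show ?thesis
        by blast
    qed
    have cover: "m \<in> L d \<or> (\<exists>d'. d = Suc d' \<and> m \<in> (\<lambda>m. m + e (p j)) ` tail_edge_monos j d')"
      if "m \<in> tail_edge_monos j d" for m d
      using div[OF that] tail_edge_monos_cases[OF that j] suc that unfolding L_def by blast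
    have L_sub: "L d \<subseteq> tail_edge_monos j d" for d
      using suc std_sub by (auto simp: L_def)
    show "tail_edge_monos j d = L d" if "d < 1" for d
      using cover[of _ d] L_sub[of d] that by auto
    show "tail_edge_monos j (d + 1) = (\<lambda>m. m + e (p j)) ` tail_edge_monos j d \<union> L (d + 1)" for d
    proof (intro equalityI subsetI)
      fix m assume "m \<in> tail_edge_monos j (d + 1)"
      from cover[OF this] show "m \<in> (\<lambda>m. m + e (p j)) ` tail_edge_monos j d \<union> L (d + 1)"
        by auto
    next
      fix m assume "m \<in> (\<lambda>m. m + e (p j)) ` tail_edge_monos j d \<union> L (d + 1)"
      then consider m' where "m = m' + e (p j)" "m' \<in> tail_edge_monos j d" | "m \<in> L (d + 1)"
        by blast
      then show "m \<in> tail_edge_monos j (d + 1)"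
      proof cases
        case 1
        then have m': "m' \<in> edge_monos q ed d" "m' \<in> range val"
          by (auto simp: tail_edge_monos_def edge_monos_eq)
        have "\<not> meets i m" if "i < j" for i
        proof -
          have "i < k" "p j \<noteq> p i" "p j \<noteq> s i" "\<not> meets i m'"
            using that j 1(2) by (auto simp: tail_edge_monos_def)
          then show ?thesis
            unfolding 1(1) using meets_add_edge[OF _ pj m'(2), of i] by blast
        qed
        then show ?thesis
          using edge_monos_add_edge[OF m'(1) pj] by (simp add: tail_edge_monos_def 1(1))
      next
        case 2
        then show ?thesis
          using L_sub by blast
      qed
    qed
    show "(\<lambda>m. m + e (p j)) ` tail_edge_monos j d \<inter> L (d + 1) = {}" for d
    proof -
      have "divides_by_p j (m + e (p j))" if "m \<in> tail_edge_monos j d" for m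
        using that j by (intro divides_by_p_add_p) (auto simp: tail_edge_monos_def edge_monos_eq)
      moreover have "\<not> divides_by_p j m" if "m \<in> L (d + 1)" for m
        using that std_monos_not_divides[OF _ j] suc divides_by_p_imp_meets unfolding L_def by blast
      ultimately show ?thesis
        by blast
    qed
  qed (simp_all add: L_def finite_std_monos finite_tail_edge_monos)
  moreover have "count_series L = count_series (std_monos j) + count_series (tail_edge_monos (Suc j))"
  proof -
    have "card (L d) = card (std_monos j d) + card (tail_edge_monos (Suc j) d)" for d
    proof -
      have "val ` std_monos j d \<inter> tail_edge_monos (Suc j) d = {}"
        using std_meets suc by blast
      moreover have "inj_on val (std_monos j d)"
        using val_inj_p_free std_monos_p_free(1)[OF _ j] by (meson inj_onI)
      ultimately show ?thesis
        unfolding L_def by (simp add: card_Un_disjoint finite_std_monos finite_tail_edge_monos card_image)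
    qed
    then show ?thesis
      by (simp add: count_series_def fps_eq_iff)
  qed
  ultimately show ?thesis
    by simp
qed

lemma count_tail_edge_monos_k:
  "count_series (tail_edge_monos k) = count_series (monos_on {..<2 * N})"
proof -
  have "card (tail_edge_monos k d) = card (monos_on {..<2 * N} d)" for d
  proof -
    have pf: "p_free u" if "u \<in> monos_on {..<2 * N} d" for u
      using that q_ge by (intro p_freeI) (auto simp: monos_on_def)
    have "tail_edge_monos k d = val ` monos_on {..<2 * N} d"
    proof (intro equalityI subsetI)
      fix m assume m: "m \<in> tail_edge_monos k d"
      then obtain c where c: "m = val c" "c \<in> monos_on {..<q} d"
        by (auto simp: tail_edge_monos_def edge_monos_eq)
      have z: "c (p i) = 0 \<and> c (s i) = 0" if "i < k" for i
        using m that by (auto simp: tail_edge_monos_def c(1) meets_val)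
      have "c x = 0" if "x \<notin> {..<2 * N}" for x
      proof (cases "x < q")
        case True
        then show ?thesis
          by (cases rule: index_cases) (use that AB_lt z in auto)
      qed (use c(2) in \<open>auto simp: monos_on_def\<close>)
      moreover from this have "sum c {..<q} = sum c {..<2 * N}"
        using q_ge by (intro sum.mono_neutral_right) auto
      ultimately have "c \<in> monos_on {..<2 * N} d"
        using c(2) by (auto simp: monos_on_def)
      then show "m \<in> val ` monos_on {..<2 * N} d"
        using c(1) by blast
    next
      fix m assume "m \<in> val ` monos_on {..<2 * N} d"
      then obtain c where c: "m = val c" "c \<in> monos_on {..<2 * N} d"
        by blast
      have "sum c {..<q} = sum c {..<2 * N}"
        using q_ge c(2) by (intro sum.mono_neutral_right) (auto simp: monos_on_def)
      then have "m \<in> edge_monos q ed d"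
        using val_edge_monosI[of c] c by (simp add: monos_on_def)
      then show "m \<in> tail_edge_monos k d"
        using c by (auto simp: tail_edge_monos_def meets_val monos_on_def)
    qed
    moreover have "inj_on val (monos_on {..<2 * N} d)"
      using val_inj_p_free pf by (meson inj_onI)
    ultimately show ?thesis
      by (simp add: card_image)
  qed
  then show ?thesis
    by (simp add: count_series_def)
qed

lemma count_tail_edge_monos:
  assumes "l \<le> k"
  shows "count_series (tail_edge_monos (k - l)) * (1 - fps_X) ^ (2 * N + l) = fps_of_poly (h_poly N l)"
  using assms
proof (induction l)
  case 0
  then show ?case
    using count_series_monos_on[of "{..<2 * N}"] by (simp add: count_tail_edge_monos_k)
next
  case (Suc l)
  define j where "j = k - Suc l"
  have j: "j < k" "Suc j = k - l" "k - j = Suc l"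
    using Suc.prems by (auto simp: j_def)
  define D :: "int fps" where "D = (1 - fps_X) ^ (2 * N + l)"
  define G0 Gj where "G0 = count_series (monos_on {..<2 * N})" and "Gj = count_series (monos_on (tail_vars j))"
  have G0: "G0 * (1 - fps_X) ^ (2 * N) = 1"
    using count_series_monos_on[of "{..<2 * N}"] by (simp add: G0_def)
  have Gj: "Gj * (D * (1 - fps_X)) = 1"
    using count_series_monos_on[OF finite_tail_vars, of j] card_tail_vars[of j] j
    by (simp add: Gj_def D_def mult_ac)
  have IH: "count_series (tail_edge_monos (Suc j)) * D = fps_of_poly (h_poly N l)"
    using Suc j(2) by (simp add: D_def)
  have step: "count_series (tail_edge_monos j) * (1 - fps_X)
      = count_series (std_monos j) + count_series (tail_edge_monos (Suc j))"
    using count_tail_edge_monos_step[OF j(1)] by (simp add: algebra_simps)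
  have "count_series (tail_edge_monos j) * (1 - fps_X) * D
      = fps_X ^ (N + 1) * (G0 * D) + fps_X * (1 - fps_X ^ N) * (Gj * D) + count_series (tail_edge_monos (Suc j)) * D"
    unfolding step by (simp add: count_std_monos[OF j(1)] count_non_B_monos G0_def Gj_def algebra_simps)
  also have "fps_X * (1 - fps_X ^ N) * (Gj * D) = fps_of_poly (h_step N) * (Gj * (D * (1 - fps_X)))"
    unfolding fps_of_poly_h_step[symmetric] by (simp add: mult_ac)
  also have "\<dots> = fps_of_poly (h_step N)"
    by (simp add: Gj)
  \<comment> \<open>The multiples of \<open>B s_j\<close> cancel only \<open>2 * N\<close> of the
    factors of \<open>D\<close>; the remaining ones raise the degree of the numerator.\<close>
  also have "G0 * D = (1 - fps_X) ^ l"
    unfolding D_def power_add mult.assoc[symmetric] G0 by simp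
  finally show ?case
    unfolding IH j_def[symmetric]
    by (simp add: D_def fps_of_poly_add fps_of_poly_mult fps_of_poly_power fps_of_poly_one_minus_X
        fps_of_poly_monom mult_ac add_ac)
qed

lemma h_polynomial:
  assumes "0 < k"
  shows "is_h_polynomial q ed (h_poly N k)" "degree (h_poly N k) = N + k"
proof -
  have "tail_edge_monos 0 d = edge_monos q ed d" for d
    by (simp add: tail_edge_monos_def)
  then have "hilbert_series q ed = count_series (tail_edge_monos 0)"
    by (simp add: hilbert_series_def count_series_def hilbert_fun_def)
  then have "fps_of_poly (h_poly N k) = hilbert_series q ed * (1 - fps_X) ^ (2 * N + k)"
    using count_tail_edge_monos[of k] by simp
  then show "is_h_polynomial q ed (h_poly N k)"
    unfolding is_h_polynomial_def using poly_h_poly_pos[of N k] by (metis less_irrefl)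
  show "degree (h_poly N k) = N + k"
    using degree_h_poly[of N "k - 1"] assms by simp
qed

end

section \<open>The graph\<close>

text \<open>Vertex 0 is \<open>x\<close>, vertex \<open>2 * a + 1\<close> is \<open>y\<close>, and
  \<open>2 * a + 4 + j\<close> is \<open>z_j\<close>. The numbering makes parity separate
  \<open>A\<close> from \<open>B\<close>: the two cycle edges at \<open>x\<close> are both even, the
  two triangle edges at \<open>y\<close> both odd, and edges alternate at every other vertex of the
  cycles.\<close>

definition cycle_pair_edges :: "nat \<Rightarrow> nat \<Rightarrow> nat \<Rightarrow> nat set" where
  "cycle_pair_edges a k i =
    (if i < 2 * a then {i, Suc i} else if i = 2 * a then {0, i}
     else if i < 2 * a + 3 then {i, Suc i} else if i = 2 * a + 3 then {2 * a + 1, i}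
     else if i < 2 * a + 4 + k then {0, i} else {2 * a + 1, i - k})"

text \<open>For \<open>a = 0\<close> the first edge would degenerate to \<open>{0, 0}\<close>; this
  is the source of the bound 4 for \<open>r\<close>.\<close>

lemma simple_graph_cycle_pair:
  assumes "0 < a"
  shows "simple_graph (2 * a + 4 + k) (2 * a + 4 + 2 * k) (cycle_pair_edges a k)"
  unfolding simple_graph_def
proof (intro conjI allI impI)
  fix i assume "i < 2 * a + 4 + 2 * k"
  then show "cycle_pair_edges a k i \<subseteq> {..<2 * a + 4 + k}" "card (cycle_pair_edges a k i) = 2"
    using assms by (auto simp: cycle_pair_edges_def card_insert_if)
next
  show "inj_on (cycle_pair_edges a k) {..<2 * a + 4 + 2 * k}"
    using assms by (auto simp: inj_on_def cycle_pair_edges_def doubleton_eq_iff split: if_splits)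
qed

lemma connected_cycle_pair:
  assumes "0 < a" "0 < k"
  shows "connected_graph (2 * a + 4 + k) (2 * a + 4 + 2 * k) (cycle_pair_edges a k)"
proof -
  let ?q = "2 * a + 4 + 2 * k"
  define E where "E = {(x, y). \<exists>i<?q. cycle_pair_edges a k i = {x, y}}"
  have sym: "sym (E\<^sup>*)"
    by (intro sym_rtrancl) (auto simp: sym_def E_def insert_commute)
  have edge: "(x, y) \<in> E\<^sup>*" if "i < ?q" "cycle_pair_edges a k i = {x, y}" for x y i
    using that by (auto simp: E_def)
  have cyc: "(v, 0) \<in> E\<^sup>*" if "v \<le> 2 * a" for v
    using that
  proof (induction v)
    case (Suc v)
    have "(Suc v, v) \<in> E\<^sup>*"
      using Suc.prems by (intro edge[of v]) (auto simp: cycle_pair_edges_def)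
    then show ?case
      using Suc by simp
  qed simp
  have z: "(2 * a + 4 + j, 0) \<in> E\<^sup>*" if "j < k" for j
    using that by (intro edge[of "2 * a + 4 + j"]) (auto simp: cycle_pair_edges_def)
  \<comment> \<open>The two cycles are linked through \<open>z_0\<close>, which exists since
    \<open>k > 0\<close>.\<close>
  have "(2 * a + 1, 2 * a + 4) \<in> E\<^sup>*"
    using assms by (intro edge[of "2 * a + 4 + k"]) (auto simp: cycle_pair_edges_def)
  then have y: "(2 * a + 1, 0) \<in> E\<^sup>*"
    using z[of 0] assms by simp
  have "(2 * a + 2, 2 * a + 1) \<in> E\<^sup>*"
    by (intro edge[of "2 * a + 1"]) (auto simp: cycle_pair_edges_def)
  then have y1: "(2 * a + 2, 0) \<in> E\<^sup>*"
    using y by simp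
  have "(2 * a + 3, 2 * a + 1) \<in> E\<^sup>*"
    by (intro edge[of "2 * a + 3"]) (auto simp: cycle_pair_edges_def)
  then have y2: "(2 * a + 3, 0) \<in> E\<^sup>*"
    using y by simp
  have to0: "(v, 0) \<in> E\<^sup>*" if "v < 2 * a + 4 + k" for v
  proof -
    consider "v \<le> 2 * a" | "v = 2 * a + 1" | "v = 2 * a + 2" | "v = 2 * a + 3" | "2 * a + 4 \<le> v"
      by linarith
    then show ?thesis
    proof cases
      case 5
      then show ?thesis
        using z[of "v - (2 * a + 4)"] that by simp
    qed (use cyc y y1 y2 in auto)
  qed
  have "(u, v) \<in> E\<^sup>*" if "u < 2 * a + 4 + k" "v < 2 * a + 4 + k" for u v
    using to0[OF that(1)] symD[OF sym to0[OF that(2)]] by simp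
  then show ?thesis
    unfolding connected_graph_def E_def by simp
qed

lemma edge_val_cycle_pair:
  fixes c :: "nat \<Rightarrow> nat" and a k :: nat
  assumes "0 < a"
  defines "w \<equiv> edge_val (2 * a + 4 + 2 * k) (cycle_pair_edges a k) c"
  shows "w 0 = c 0 + c (2 * a) + (\<Sum>j<k. c (2 * a + 4 + j))"
    and "i < 2 * a \<Longrightarrow> w (Suc i) = c i + c (Suc i)"
    and "w (2 * a + 1) = c (2 * a + 1) + c (2 * a + 3) + (\<Sum>j<k. c (2 * a + 4 + k + j))"
    and "w (2 * a + 2) = c (2 * a + 1) + c (2 * a + 2)"
    and "w (2 * a + 3) = c (2 * a + 2) + c (2 * a + 3)"
    and "j < k \<Longrightarrow> w (2 * a + 4 + j) = c (2 * a + 4 + j) + c (2 * a + 4 + k + j)"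
    and "2 * a + 4 + k \<le> v \<Longrightarrow> w v = 0"
proof -
  let ?ed = "cycle_pair_edges a k"
  have split: "sum f {..<m + n} = sum f {..<m} + (\<Sum>j<n. f (m + j))" for m n and f :: "nat \<Rightarrow> nat"
    by (induction n) (auto simp: add.assoc)
  have w: "w v = (\<Sum>i | i < 2 * a + 4 \<and> v \<in> ?ed i. c i)
      + (\<Sum>j<k. if v = 0 \<or> v = 2 * a + 4 + j then c (2 * a + 4 + j) else 0)
      + (\<Sum>j<k. if v = 2 * a + 1 \<or> v = 2 * a + 4 + j then c (2 * a + 4 + k + j) else 0)" for v
  proof -
    let ?f = "\<lambda>i. c i * edge_vec ?ed i v"
    have e: "2 * a + 4 + 2 * k = 2 * a + 4 + k + k"
      by simp
    have "w v = sum ?f {..<2 * a + 4} + (\<Sum>j<k. ?f (2 * a + 4 + j)) + (\<Sum>j<k. ?f (2 * a + 4 + k + j))"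
      unfolding w_def edge_val_def e by (simp only: split[of ?f "2 * a + 4 + k" k] split[of ?f "2 * a + 4" k])
    also have "sum ?f {..<2 * a + 4} = (\<Sum>i | i < 2 * a + 4 \<and> v \<in> ?ed i. c i)"
      by (rule sum.mono_neutral_cong_right) (auto simp: edge_vec_def)
    also have "(\<Sum>j<k. ?f (2 * a + 4 + j)) = (\<Sum>j<k. if v = 0 \<or> v = 2 * a + 4 + j then c (2 * a + 4 + j) else 0)"
      by (intro sum.cong) (auto simp: edge_vec_def cycle_pair_edges_def)
    also have "(\<Sum>j<k. ?f (2 * a + 4 + k + j))
        = (\<Sum>j<k. if v = 2 * a + 1 \<or> v = 2 * a + 4 + j then c (2 * a + 4 + k + j) else 0)"
      by (intro sum.cong) (auto simp: edge_vec_def cycle_pair_edges_def)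
    finally show ?thesis .
  qed
  have S0: "{i. i < 2 * a + 4 \<and> 0 \<in> ?ed i} = {0, 2 * a}"
    using assms(1) by (auto simp: cycle_pair_edges_def split: if_splits)
  have S1: "{l. l < 2 * a + 4 \<and> Suc i \<in> ?ed l} = {i, Suc i}" if "i < 2 * a" for i
    using that by (auto simp: cycle_pair_edges_def split: if_splits)
  have S2: "{i. i < 2 * a + 4 \<and> 2 * a + 1 \<in> ?ed i} = {2 * a + 1, 2 * a + 3}"
    by (auto simp: cycle_pair_edges_def split: if_splits)
  have S3: "{i. i < 2 * a + 4 \<and> 2 * a + 2 \<in> ?ed i} = {2 * a + 1, 2 * a + 2}"
    by (auto simp: cycle_pair_edges_def split: if_splits)
  have S4: "{i. i < 2 * a + 4 \<and> 2 * a + 3 \<in> ?ed i} = {2 * a + 2, 2 * a + 3}"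
    by (auto simp: cycle_pair_edges_def split: if_splits)
  have S5: "{i. i < 2 * a + 4 \<and> v \<in> ?ed i} = {}" if "2 * a + 4 \<le> v" for v
    using that by (auto simp: cycle_pair_edges_def split: if_splits)
  show "w 0 = c 0 + c (2 * a) + (\<Sum>j<k. c (2 * a + 4 + j))"
    unfolding w S0 using assms(1) by simp
  show "w (Suc i) = c i + c (Suc i)" if "i < 2 * a"
    unfolding w S1[OF that] using that by simp
  show "w (2 * a + 1) = c (2 * a + 1) + c (2 * a + 3) + (\<Sum>j<k. c (2 * a + 4 + k + j))"
    unfolding w S2 by simp
  show "w (2 * a + 2) = c (2 * a + 1) + c (2 * a + 2)"
    unfolding w S3 by simp
  show "w (2 * a + 3) = c (2 * a + 2) + c (2 * a + 3)"
    unfolding w S4 by simp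
  show "w (2 * a + 4 + j) = c (2 * a + 4 + j) + c (2 * a + 4 + k + j)" if "j < k"
    unfolding w S5[OF le_add1] using that by simp
  show "w v = 0" if "2 * a + 4 + k \<le> v"
  proof -
    have v: "2 * a + 4 \<le> v"
      using that by simp
    show ?thesis
      unfolding w S5[OF v] using that by simp
  qed
qed

text \<open>Along the odd cycle the change of the exponents alternates in sign, so both edges at
  \<open>x\<close> change by the same \<open>n\<close>. The balance at \<open>x\<close> then lowers
  the sum over the \<open>p_j\<close> by \<open>2 * n\<close>, and the vertices \<open>z_j\<close>
  pass this on as an increase for the \<open>s_j\<close>.\<close>

lemma edge_val_cycle_pair_eq_iff:
  fixes c c' :: "nat \<Rightarrow> nat" and a k :: nat
  assumes "0 < a"
  defines "val \<equiv> edge_val (2 * a + 4 + 2 * k) (cycle_pair_edges a k)"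
    and "A \<equiv> {i. i < 2 * a + 4 \<and> odd i}" and "B \<equiv> {i. i < 2 * a + 4 \<and> even i}"
  shows "val c = val c' \<longleftrightarrow> (\<exists>n :: int.
    (\<forall>j<k. c (2 * a + 4 + j) + c (2 * a + 4 + k + j) = c' (2 * a + 4 + j) + c' (2 * a + 4 + k + j)) \<and>
    (\<Sum>j<k. int (c' (2 * a + 4 + k + j))) = (\<Sum>j<k. int (c (2 * a + 4 + k + j))) + 2 * n \<and>
    (\<forall>b\<in>B. int (c' b) = int (c b) + n) \<and> (\<forall>x\<in>A. int (c' x) = int (c x) - n))"
    (is "_ \<longleftrightarrow> (\<exists>n. ?P n)")
proof
  note W = edge_val_cycle_pair[OF assms(1), where k = k, folded val_def]
  let ?p = "\<lambda>c. \<Sum>j<k. int (c (2 * a + 4 + j))" and ?s = "\<lambda>c. \<Sum>j<k. int (c (2 * a + 4 + k + j))"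
  {
    assume eq: "val c = val c'"
    define n where "n = int (c' 0) - int (c 0)"
    have cyc: "int (c' i) = int (c i) + (if even i then n else - n)" if "i \<le> 2 * a" for i
      using that
    proof (induction i)
      case (Suc i)
      have "c i + c (Suc i) = c' i + c' (Suc i)"
        using W(2)[where i = i and c = c] W(2)[where i = i and c = c'] Suc.prems eq by simp
      then show ?case
        using Suc by (auto split: if_splits)
    qed (simp add: n_def)
    have ps: "c (2 * a + 4 + j) + c (2 * a + 4 + k + j) = c' (2 * a + 4 + j) + c' (2 * a + 4 + k + j)" if "j < k" for j
      using W(6)[OF that, where c = c] W(6)[OF that, where c = c'] eq by simp
    have "?p c + ?s c = ?p c' + ?s c'"
      unfolding sum.distrib[symmetric] by (intro sum.cong) (use ps in \<open>auto simp flip: of_nat_add\<close>)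
    moreover have "int (val c 0) = int (val c' 0)"
      using eq by simp
    then have "int (c 0) + int (c (2 * a)) + ?p c = int (c' 0) + int (c' (2 * a)) + ?p c'"
      unfolding W(1) by simp
    ultimately have s: "?s c' = ?s c + 2 * n"
      using cyc[of 0] cyc[of "2 * a"] by simp
    have "int (val c (2 * a + 1)) = int (val c' (2 * a + 1))"
      using eq by simp
    then have "int (c (2 * a + 1)) + int (c (2 * a + 3)) + ?s c = int (c' (2 * a + 1)) + int (c' (2 * a + 3)) + ?s c'"
      unfolding W(3) by simp
    moreover have "c (2 * a + 1) + c (2 * a + 2) = c' (2 * a + 1) + c' (2 * a + 2)"
      "c (2 * a + 2) + c (2 * a + 3) = c' (2 * a + 2) + c' (2 * a + 3)"
      using W(4,5)[where c = c] W(4,5)[where c = c'] eq by simp_all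
    \<comment> \<open>The triangle has odd length, so the balances at its three vertices determine
      the three changes: the two edges at \<open>y\<close> share \<open>- 2 * n\<close>
      equally.\<close>
    ultimately have tri: "int (c' (2 * a + 1)) = int (c (2 * a + 1)) - n"
      "int (c' (2 * a + 2)) = int (c (2 * a + 2)) + n" "int (c' (2 * a + 3)) = int (c (2 * a + 3)) - n"
      using s by linarith+
    have all: "int (c' i) = int (c i) + (if even i then n else - n)" if "i < 2 * a + 4" for i
    proof -
      consider "i \<le> 2 * a" | "i = 2 * a + 1" | "i = 2 * a + 2" | "i = 2 * a + 3"
        using \<open>i < 2 * a + 4\<close> by linarith
      then show ?thesis
        by cases (use cyc tri in auto)
    qed
    have "?P n"
      using ps s all by (auto simp: A_def B_def)
    then show "\<exists>n. ?P n" ..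
  }
  assume "\<exists>n. ?P n"
  then obtain n where n: "\<forall>j<k. c (2 * a + 4 + j) + c (2 * a + 4 + k + j) = c' (2 * a + 4 + j) + c' (2 * a + 4 + k + j)"
    "?s c' = ?s c + 2 * n" "\<forall>b\<in>B. int (c' b) = int (c b) + n" "\<forall>x\<in>A. int (c' x) = int (c x) - n"
    by blast
  have all: "int (c' i) = int (c i) + (if even i then n else - n)" if "i < 2 * a + 4" for i
    using that n(3,4) by (auto simp: A_def B_def)
  have "?p c + ?s c = ?p c' + ?s c'"
    unfolding sum.distrib[symmetric] by (intro sum.cong) (use n(1) in \<open>auto simp flip: of_nat_add\<close>)
  then have p: "?p c' = ?p c - 2 * n"
    using n(2) by simp
  show "val c = val c'"
  proof
    fix v
    consider "v = 0" | i where "v = Suc i" "i < 2 * a" | "v = 2 * a + 1" | "v = 2 * a + 2" | "v = 2 * a + 3"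
      | j where "v = 2 * a + 4 + j" "j < k" | "2 * a + 4 + k \<le> v"
    proof -
      consider "v = 0" | "0 < v" "v \<le> 2 * a" | "v = 2 * a + 1" | "v = 2 * a + 2" | "v = 2 * a + 3"
        | "2 * a + 4 \<le> v" "v < 2 * a + 4 + k" | "2 * a + 4 + k \<le> v"
        by linarith
      then show thesis
        by cases (use that(1,3,4,5,7) that(2)[of "v - 1"] that(6)[of "v - (2 * a + 4)"] in auto)
    qed
    then show "val c v = val c' v"
    proof cases
      case 1
      have "int (val c 0) = int (val c' 0)"
        unfolding W(1) using all[of 0] all[of "2 * a"] p by simp
      then show ?thesis
        using 1 by simp
    next
      case (2 i)
      have "int (val c v) = int (val c' v)"
        unfolding 2(1) W(2)[OF 2(2)] using all[of i] all[of "Suc i"] 2(2) by simp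
      then show ?thesis
        by simp
    next
      case 3
      have "int (val c v) = int (val c' v)"
        unfolding 3 W(3) using all[of "2 * a + 1"] all[of "2 * a + 3"] n(2) by simp
      then show ?thesis
        by simp
    next
      case 4
      have "int (val c v) = int (val c' v)"
        unfolding 4 W(4) using all[of "2 * a + 1"] all[of "2 * a + 2"] by simp
      then show ?thesis
        by simp
    next
      case 5
      have "int (val c v) = int (val c' v)"
        unfolding 5 W(5) using all[of "2 * a + 2"] all[of "2 * a + 3"] by simp
      then show ?thesis
        by simp
    next
      case (6 j)
      then show ?thesis
        using W(6) n(1) by simp
    next
      case 7
      then show ?thesis
        using W(7) by simp
    qed
  qed
qed

lemma cycle_pair_fibres_graph:
  assumes "0 < a"
  shows "cycle_pair_fibres (2 * a + 4 + 2 * k) k (a + 2) (cycle_pair_edges a k)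
    {i. i < 2 * a + 4 \<and> odd i} {i. i < 2 * a + 4 \<and> even i}"
proof
  show "2 * a + 4 + 2 * k = 2 * (a + 2) + 2 * k"
    by simp
  show "{i. i < 2 * a + 4 \<and> odd i} \<union> {i. i < 2 * a + 4 \<and> even i} = {..<2 * (a + 2)}"
    by auto
  show "{i. i < 2 * a + 4 \<and> odd i} \<inter> {i. i < 2 * a + 4 \<and> even i} = {}"
    by auto
  have "{i. i < 2 * a + 4 \<and> odd i} = (\<lambda>j. 2 * j + 1) ` {..<a + 2}"
    by (auto elim!: oddE)
  then show "card {i. i < 2 * a + 4 \<and> odd i} = a + 2"
    by (simp add: card_image inj_on_def)
  have "{i. i < 2 * a + 4 \<and> even i} = (\<lambda>j. 2 * j) ` {..<a + 2}"
    by (auto elim!: evenE)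
  then show "card {i. i < 2 * a + 4 \<and> even i} = a + 2"
    by (simp add: card_image inj_on_def)
qed (unfold distrib_left_numeral, use edge_val_cycle_pair_eq_iff[OF assms] in simp)

theorem theorem1p1:
  fixes r d :: int
  assumes alg_closed: "\<forall>p :: 'k::field_char_0 poly. degree p > 0 \<longrightarrow> (\<exists>x. poly p x = 0)"
    and "4 \<le> r" and "r \<le> d"
  shows "\<exists>n q ed. simple_graph n q ed \<and> connected_graph n q ed \<and>
           regularity_is TYPE('k) q ed r \<and>
           (\<exists>h. is_h_polynomial q ed h \<and> int (degree h) = d)"
proof -
  \<comment> \<open>The regularity is \<open>N + 1 = a + 3\<close> and the degree is
    \<open>N + k = a + 2 + k\<close>; the bounds on \<open>r\<close> and \<open>d\<close> amount to
    \<open>a\<close> and \<open>k\<close> being positive.\<close>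
  define a k where "a = nat (r - 3)" and "k = nat (d - r + 1)"
  have pos: "0 < a" "0 < k" and rd: "r = int a + 3" "d = int (a + 2 + k)"
    using assms(2,3) by (auto simp: a_def k_def)
  let ?q = "2 * a + 4 + 2 * k" and ?ed = "cycle_pair_edges a k"
  interpret cycle_pair_fibres ?q k "a + 2" ?ed "{i. i < 2 * a + 4 \<and> odd i}" "{i. i < 2 * a + 4 \<and> even i}"
    using pos(1) by (rule cycle_pair_fibres_graph)
  have "regularity_is TYPE('k) ?q ?ed r"
    unfolding regularity_is_def
  proof (intro conjI allI impI exI)
    show "betti TYPE('k) ?q ?ed 1 (a + 2 + 2) \<noteq> 0"
      by (rule betti_generator[OF pos(2)])
    show "int (a + 2 + 2) - int 1 = r"
      by (simp add: rd)
    fix i j assume "betti TYPE('k) ?q ?ed i j \<noteq> 0"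
    then have "\<not> i + (a + 2) + 2 \<le> j"
      using betti_eq_0[where 'a = 'k and i = i and d = j] by auto
    then show "int j - int i \<le> r"
      by (simp add: rd)
  qed
  moreover have "int (degree (h_poly (a + 2) k)) = d"
    using h_polynomial(2)[OF pos(2)] by (simp add: rd)
  ultimately show ?thesis
    using simple_graph_cycle_pair[OF pos(1)] connected_cycle_pair[OF pos] h_polynomial(1)[OF pos(2)]
    by (intro exI conjI)
qed

end
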